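(* Let $l$ be a prime number. If the formal sum $\theta_l=\sum_{M\in S_l}M$ satisfies the condition $\mathscr{C}_l$, then for all real $x>0$, $y>0$ with $x\neq y$, $$\mathcal{HZ}|_{\theta_l}(x,y)\equiv (l+1)\,\mathcal{HZ}(x,y)+\frac{l-1}{2}\log(l)\log\left(\frac{x}{y}\right)\mod \zeta(2),$$ i.e. the difference of the two sides lies in $\zeta(2)\mathbb{Z}$, where $\zeta(2)=\pi^2/6$.
   Context: **Herglotz-Zagier functions.** For $x\in\mathbb{C}\setminus(-\infty,0]$ put $HZ(x)=\sum_{n=1}^\infty \frac1n\left(\psi(nx)-\log(nx)\right)$, where $\psi$ is the digamma function, and $$\widetilde{HZ}(x)=HZ(x)-HZ(1)+\frac{\pi^2}{12}\left(x-2+x^{-1}\right)-\frac{\log^2 x}{4}.$$ Let $\mathrm{Li}_2(x)=\sum_{n\ge1}x^n/n^2$. The Rogers dilogarithm $L:\mathbb{R}_{>0}\setminus\{1\}\to\mathbb{R}$ is $L(x)=\mathrm{Li}_2(x)+\frac12\log(x)\log(1-x)$ for $0<x<1$ and $L(x)=\frac{\pi^2}{3}-L(1/x)$ for $x>1$. The refined Herglotz-Zagier function is $$\mathcal{HZ}(x,y)=\widetilde{HZ}(x)-\widetilde{HZ}(y)+L\left(\frac{y}{x}\right)\qquad(x>0,\ y>0,\ x\ne y).$$ **The set $S_l$ and the slash operation.** Let $$S_l=\left\{\begin{pmatrix}a&b\\c&d\end{pmatrix}\in \mathrm{M}_2(\mathbb{Z}) : 0\le b<a,\ 0\le c<d,\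 ad-bc=l\right\},\qquad \theta_l=\sum_{M\in S_l}M\in\mathbb{Z}[S_l].$$ For a complex-valued function $f(x_1,\dots,x_n)$ and $M=\begin{pmatrix}a&b\\c&d\end{pmatrix}$ define $$f|_M(x_1,\dots,x_n)=f\left(\frac{ax_1+c}{bx_1+d},\dots,\frac{ax_n+c}{bx_n+d}\right),\qquad f|_{\theta_l}=\sum_{M\in S_l}f|_M .$$ **Condition $\mathscr{C}_n$.** For an integer $n$ let $\mathrm{M}_2(\mathbb{Z})_n$ be the set of integer $2\times2$ matrices of determinant $n$, on which $\mathrm{SL}_2(\mathbb{Z})$ acts by right multiplication. For $M\in \mathrm{M}_2(\mathbb{Z})_n$ let $M\infty$ and $M0$ be the points of $\mathbb{P}^1_{\mathbb{R}}$ given by the columns $M\begin{pmatrix}1\\0\end{pmatrix}$ and $M\begin{pmatrix}0\\1\end{pmatrix}$ respectively (the column $\begin{pmatrix}p\\ q\end{pmatrix}$ representing the point $p/q$, so that $\infty$ and $0$ are represented by $\begin{pmatrix}1\\0\end{pmatrix}$ and $\begin{pmatrix}0\\1\end{pmatrix}$). A formal sum $T=\sum_M u_M(M)\in\mathbb{Z}[\mathrm{M}_2(\mathbb{Z})_n]$ satisfies $\mathscr{C}_n$ if for every class (orbit) $\alpha\in \mathrm{M}_2(\mathbb{Z})_n/\mathrm{SL}_2(\mathbb{Z})$ one has, in $\mathbb{Z}[\mathbb{P}^1_{\mathbb{R}}]$, $$\sum_{M\in\alpha}u_M\left((M\infty)-(M0)\right)=(\infty)-(0).$$ *)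

theory Defs
  imports "HOL-Analysis.Analysis" "HOL-Library.Poly_Mapping"
begin

subsection \<open>Herglotz--Zagier functions\<close>

text \<open>Here \<open>x\<close> ranges over the complex plane slit along the nonpositive reals, and \<open>Ln\<close> is the
  principal branch.\<close>

definition HZ :: "complex \<Rightarrow> complex" where
  "HZ x = suminf (\<lambda>k. (Digamma (of_nat (Suc k) * x) - Ln (of_nat (Suc k) * x)) / of_nat (Suc k))"

definition HZ_tilde :: "complex \<Rightarrow> complex" where
  "HZ_tilde x = HZ x - HZ 1 + (of_real pi)\<^sup>2 / 12 * (x - 2 + inverse x) - (Ln x)\<^sup>2 / 4"

definition Li2 :: "real \<Rightarrow> real" where
  "Li2 x = suminf (\<lambda>k. x ^ Suc k / (real (Suc k))\<^sup>2)"

definition Rogers_L01 :: "real \<Rightarrow> real" where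
  "Rogers_L01 x = Li2 x + 1 / 2 * ln x * ln (1 - x)"

text \<open>Only meaningful for \<open>x > 0\<close>, \<open>x \<noteq> 1\<close>.\<close>

definition Rogers_L :: "real \<Rightarrow> real" where
  "Rogers_L x = (if x < 1 then Rogers_L01 x else pi\<^sup>2 / 3 - Rogers_L01 (1 / x))"

text \<open>Only meaningful for \<open>x > 0\<close>, \<open>y > 0\<close>, \<open>x \<noteq> y\<close>.\<close>

definition refined_HZ :: "real \<Rightarrow> real \<Rightarrow> complex" where
  "refined_HZ x y = HZ_tilde (of_real x) - HZ_tilde (of_real y) + of_real (Rogers_L (y / x))"


subsection \<open>The set \<open>S\<^sub>l\<close>, its formal sum, and the slash operation\<close>

definition S_set :: "int \<Rightarrow> (int^2^2) set" where
  "S_set l = {M. 0 \<le> M$1$2 \<and> M$1$2 < M$1$1 \<and> 0 \<le> M$2$1 \<and> M$2$1 < M$2$2 \<and> det M = l}"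

text \<open>Finiteness matters because the sums below would be 0 over an infinite index set.\<close>

lemma finite_S_set: "finite (S_set l)"
proof -
  let ?f = "\<lambda>M :: int^2^2. (M$1$1, M$1$2, M$2$1, M$2$2)"
  have inj: "inj_on ?f (S_set l)"
    by (auto simp: inj_on_def vec_eq_iff forall_2)
  have "?f ` S_set l \<subseteq> {0..l} \<times> {0..l} \<times> {0..l} \<times> {0..l}"
  proof (rule image_subsetI)
    fix M assume "M \<in> S_set l"
    then obtain a b c d where M: "a = M$1$1" "b = M$1$2" "c = M$2$1" "d = M$2$2"
      and *: "0 \<le> b" "b < a" "0 \<le> c" "c < d" "a * d - b * c = l"
      by (auto simp: S_set_def det_2)
    have "b * c \<le> (a - 1) * (d - 1)"
      using * by (intro mult_mono) auto
    then have "a + d - 1 \<le> l"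
      using * by (simp add: algebra_simps)
    then show "?f M \<in> {0..l} \<times> {0..l} \<times> {0..l} \<times> {0..l}"
      using * M by auto
  qed
  then have "finite (?f ` S_set l)"
    by (rule finite_subset) auto
  then show ?thesis
    using inj by (rule finite_imageD)
qed

definition theta :: "int \<Rightarrow> (int^2^2) \<Rightarrow>\<^sub>0 int" where
  "theta l = (\<Sum>M\<in>S_set l. frag_of M)"

text \<open>The coefficients enter transposed: \<open>x\<close> is sent to \<open>(a x + c) / (b x + d)\<close>.\<close>

definition moebius_tr :: "int^2^2 \<Rightarrow> real \<Rightarrow> real" where
  "moebius_tr M x =
     (of_int (M$1$1) * x + of_int (M$2$1)) / (of_int (M$1$2) * x + of_int (M$2$2))"

definition slash :: "(real \<Rightarrow> real \<Rightarrow> complex) \<Rightarrow> int^2^2 \<Rightarrow> real \<Rightarrow> real \<Rightarrow> complex" where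
  "slash f M x y = f (moebius_tr M x) (moebius_tr M y)"

definition slash_theta :: "(real \<Rightarrow> real \<Rightarrow> complex) \<Rightarrow> int \<Rightarrow> real \<Rightarrow> real \<Rightarrow> complex" where
  "slash_theta f l x y = (\<Sum>M\<in>S_set l. slash f M x y)"


subsection \<open>The real projective line\<close>

definition proj_rel :: "real^2 \<Rightarrow> real^2 \<Rightarrow> bool" where
  "proj_rel v w \<longleftrightarrow> v \<noteq> 0 \<and> w \<noteq> 0 \<and> (\<exists>c. c \<noteq> 0 \<and> w = c *\<^sub>R v)"

lemma part_equivp_proj_rel: "part_equivp proj_rel"
proof (rule part_equivpI)
  show "\<exists>v. proj_rel v v"
    by (rule exI[of _ "axis 1 1"]) (auto simp: proj_rel_def axis_eq_0_iff intro!: exI[of _ 1])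
  show "symp proj_rel"
  proof (rule sympI)
    fix v w assume "proj_rel v w"
    then obtain c where "v \<noteq> 0" "w \<noteq> 0" "c \<noteq> 0" "w = c *\<^sub>R v"
      by (auto simp: proj_rel_def)
    then show "proj_rel w v"
      unfolding proj_rel_def by (intro conjI exI[of _ "inverse c"]) auto
  qed
  show "transp proj_rel"
  proof (rule transpI)
    fix u v w assume "proj_rel u v" "proj_rel v w"
    then obtain c d where "u \<noteq> 0" "w \<noteq> 0" "c \<noteq> 0" "d \<noteq> 0" "v = c *\<^sub>R u" "w = d *\<^sub>R v"
      by (auto simp: proj_rel_def)
    then show "proj_rel u w"
      unfolding proj_rel_def by (intro conjI exI[of _ "d * c"]) auto
  qed
qed

quotient_type proj_line = "real^2" / partial: proj_rel
  by (rule part_equivp_proj_rel)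

text \<open>The point represented by a nonzero integer column; meaningless for the zero column.\<close>

definition proj_point :: "int^2 \<Rightarrow> proj_line" where
  "proj_point v = abs_proj_line (\<chi> i. of_int (v$i))"

abbreviation col_infty :: "int^2" where "col_infty \<equiv> vector [1, 0]"
abbreviation col_zero :: "int^2" where "col_zero \<equiv> vector [0, 1]"


subsection \<open>The condition \<open>C\<^sub>n\<close>\<close>

definition M2 :: "int \<Rightarrow> (int^2^2) set" where
  "M2 n = {M. det M = n}"

definition SL2_orbit_rel :: "int \<Rightarrow> ((int^2^2) \<times> (int^2^2)) set" where
  "SL2_orbit_rel n = {(M, M ** g) | M g. M \<in> M2 n \<and> det g = 1}"

text \<open>Orbits are infinite, so the sum over an orbit is restricted to the support of \<open>T\<close>.\<close>

definition cond_C :: "int \<Rightarrow> ((int^2^2) \<Rightarrow>\<^sub>0 int) \<Rightarrow> bool" where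
  "cond_C n T \<longleftrightarrow> Poly_Mapping.keys T \<subseteq> M2 n \<and>
     (\<forall>\<alpha> \<in> M2 n // SL2_orbit_rel n.
        (\<Sum>M \<in> \<alpha> \<inter> Poly_Mapping.keys T. frag_cmul (Poly_Mapping.lookup T M)
            (frag_of (proj_point (M *v col_infty)) - frag_of (proj_point (M *v col_zero))))
        = frag_of (proj_point col_infty) - frag_of (proj_point col_zero))"

end

theory Submission
  imports Defs "HOL-Real_Asymp.Real_Asymp"
begin

text \<open>
  The derivative of the Herglotz function is a regularised lattice sum over a cone, and a Hecke
  operator acts on such sums by counting sublattices.

  For \<open>x > 0\<close> let \<open>E x\<close> be the derivative of \<open>HZ\<close> plus \<open>\<pi>\<^sup>2 / 12 (1 - 1 / x\<^sup>2)\<close>; it is called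
  \<open>regular_cone_sum\<close> below. It is the finite part of the sum of \<open>1 / (p x + q)\<^sup>2\<close> over the nonzero
  lattice points \<open>(p, q)\<close> of the first quadrant, where points on the boundary count one half
  (\<open>tendsto_cone_sum\<close>). A matrix \<open>M\<close> in \<open>S_set l\<close> carries the quadrant to the cone spanned by its
  columns, and the lattice of all integer vectors to a sublattice of index \<open>l\<close> that depends only on
  the class of \<open>M\<close>. The condition \<open>cond_C\<close> tells that, for each of the \<open>l + 1\<close> sublattices, the
  cones of the matrices in its class fill the quadrant exactly once
  (\<open>cone_weight_orbit_sum\<close>). A vector lies in all \<open>l + 1\<close> sublattices if it is divisible by \<open>l\<close>, and
  in exactly one of them otherwise (\<open>sum_in_lattice\<close>). With the exponent \<open>2 + s\<close> in place of \<open>2\<close>,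
  where everything converges, these facts give the Hecke relation \<open>cone_sum_hecke\<close>. In the limit
  \<open>s \<rightarrow> 0\<close> it becomes a Hecke relation for \<open>E\<close> with logarithmic corrections that stem from the pole of
  the zeta function (\<open>regular_cone_sum_hecke\<close>).

  The partial derivative of the refined function in \<open>x\<close> is the sum of \<open>E x\<close> and an elementary function
  of \<open>x\<close> and \<open>y\<close>, the \<open>dilog_kernel\<close>. Up to explicit logarithms the action of \<open>M\<close> on the latter
  produces the difference between the two columns of \<open>M\<close> of a function that is homogeneous of degree
  \<open>0\<close>, and such differences are summed by the condition again (\<open>dilog_kernel_hecke\<close>). The logarithms
  from both parts cancel except for \<open>(l - 1) / 2 ln l / x\<close>, the derivative of the logarithmic term
  of the theorem.

  So for fixed \<open>y\<close> the difference of the two sides is locally constant in \<open>x\<close> outside \<open>x = y\<close>.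
  Since the Rogers dilogarithm extends continuously to \<open>1\<close> with the value \<open>\<pi>\<^sup>2 / 6\<close>, the difference
  is continuous at \<open>x = y\<close> too, and there it equals \<open>card (S_set l) - (l + 1)\<close> times \<open>\<pi>\<^sup>2 / 6\<close>. This
  is its value everywhere (\<open>refined_hecke_constant\<close>).
\<close>

section \<open>Hurwitz sums\<close>

text \<open>The Hurwitz zeta function at \<open>1 + p\<close>; the shifted exponent puts its pole at \<open>p = 0\<close>.\<close>

definition hurwitz :: "real \<Rightarrow> real \<Rightarrow> real" where
  "hurwitz p z = suminf (\<lambda>m. (z + real m) powr (- (1 + p)))"

lemma powr_telescope_bounds:
  fixes p u :: real
  assumes "p > 0" "u > 0"
  shows "p * (u + 1) powr (- (1 + p)) \<le> u powr (- p) - (u + 1) powr (- p)"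
    and "u powr (- p) - (u + 1) powr (- p) \<le> p * u powr (- (1 + p))"
proof -
  have "\<exists>t. u < t \<and> t < u + 1 \<and>
      (u + 1) powr (- p) - u powr (- p) = (u + 1 - u) * (- p * t powr (- (1 + p)))"
  proof (rule MVT2)
    fix t assume "u \<le> t" "t \<le> u + 1"
    moreover have "- p - 1 = - (1 + p)"
      by simp
    ultimately show "((\<lambda>t. t powr (- p)) has_real_derivative - p * t powr (- (1 + p))) (at t)"
      using has_real_derivative_powr[of t "- p"] assms by (metis less_le_trans)
  qed (use assms in auto)
  then obtain t where t: "u < t" "t < u + 1"
      "u powr (- p) - (u + 1) powr (- p) = p * t powr (- (1 + p))"
    by force
  show "p * (u + 1) powr (- (1 + p)) \<le> u powr (- p) - (u + 1) powr (- p)"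
    unfolding t(3) using t assms by (intro mult_left_mono powr_mono2') auto
  show "u powr (- p) - (u + 1) powr (- p) \<le> p * u powr (- (1 + p))"
    unfolding t(3) using t assms by (intro mult_left_mono powr_mono2') auto
qed

text \<open>All three facts come from squeezing the terms between consecutive differences of
  \<open>(z + m) powr (- p) / p\<close>, a telescoping series with sum \<open>z powr (- p) / p\<close>.\<close>

lemma
  fixes p z :: real
  assumes p: "p > 0" and z: "z > 0"
  shows summable_hurwitz: "summable (\<lambda>m. (z + real m) powr (- (1 + p)))"
    and hurwitz_ge: "z powr (- p) / p \<le> hurwitz p z"
    and hurwitz_le: "hurwitz p z \<le> z powr (- p) / p + z powr (- (1 + p))"
proof -
  \<comment> \<open>A discrete antiderivative of the terms, up to the error controlled by \<open>powr_telescope_bounds\<close>.\<close>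
  define t where "t m = (z + real m) powr (- p) / p" for m
  have "t \<longlonglongrightarrow> 0"
    unfolding t_def using p by real_asymp
  then have tel: "(\<lambda>m. t m - t (Suc m)) sums t 0"
    using telescope_sums'[of t 0] by simp
  have lo: "t m - t (Suc m) \<le> (z + real m) powr (- (1 + p))"
    and hi: "(z + real (Suc m)) powr (- (1 + p)) \<le> t m - t (Suc m)" for m
    using powr_telescope_bounds[of p "z + real m"] p z
    by (simp_all add: t_def add_ac field_simps)
  have sS: "summable (\<lambda>m. (z + real (Suc m)) powr (- (1 + p)))"
    using hi by (intro summable_comparison_test[OF _ sums_summable[OF tel]]) auto
  then show s: "summable (\<lambda>m. (z + real m) powr (- (1 + p)))"
    by (subst (asm) summable_Suc_iff)
  show "z powr (- p) / p \<le> hurwitz p z"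
    unfolding hurwitz_def
    using suminf_le[OF lo sums_summable[OF tel] s] sums_unique[OF tel] by (simp add: t_def)
  show "hurwitz p z \<le> z powr (- p) / p + z powr (- (1 + p))"
    unfolding hurwitz_def
    using suminf_le[OF hi sS sums_summable[OF tel]] sums_unique[OF tel] suminf_split_head[OF s]
    by (simp add: t_def)
qed

lemma powr_minus_two_nat: "z > 0 \<Longrightarrow> (z :: real) powr (- 2) = inverse (z ^ 2)"
  by (simp add: powr_minus powr_numeral)

lemma Trigamma_eq_hurwitz:
  fixes z :: real
  assumes "z > 0"
  shows "Polygamma 1 z = hurwitz 1 z"
proof -
  have "(\<lambda>k. inverse ((z + real k) ^ Suc 1)) sums Polygamma 1 z"
    using Polygamma_LIMSEQ[of z 1] assms by simp
  moreover have "inverse ((z + real k) ^ Suc 1) = (z + real k) powr (- (1 + 1))" for k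
    using powr_minus_two_nat[of "z + real k"] assms by (simp add: power2_eq_square)
  ultimately show ?thesis
    by (simp add: hurwitz_def sums_iff)
qed

text \<open>This is what makes the termwise derivative of the Herglotz series converge locally uniformly.\<close>

lemma Trigamma_bounds:
  fixes z :: real
  assumes "z > 0"
  shows "\<bar>Polygamma 1 z - 1 / z\<bar> \<le> 1 / z\<^sup>2"
proof -
  have "1 / z \<le> hurwitz 1 z"
    using hurwitz_ge[of 1 z] assms by (simp add: powr_minus_divide)
  moreover have "hurwitz 1 z \<le> 1 / z + 1 / z\<^sup>2"
    using hurwitz_le[of 1 z] assms powr_minus_two_nat[of z]
    by (simp add: powr_minus_divide inverse_eq_divide)
  ultimately show ?thesis
    unfolding Trigamma_eq_hurwitz[OF assms] by linarith
qed

section \<open>The Herglotz function and its derivative\<close>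

lemma summable_inverse_square_Suc: "summable (\<lambda>n. 1 / (real (Suc n))\<^sup>2)"
  using sums_summable[OF inverse_squares_sums] by (simp add: add_ac)

definition herglotz :: "real \<Rightarrow> real" where
  "herglotz x = suminf (\<lambda>n. (Digamma (real (Suc n) * x) - ln (real (Suc n) * x)) / real (Suc n))"

definition herglotz_deriv :: "real \<Rightarrow> real" where
  "herglotz_deriv x = suminf (\<lambda>n. Polygamma 1 (real (Suc n) * x) - 1 / (real (Suc n) * x))"

text \<open>Termwise differentiation needs convergence at one point. At \<open>1\<close> the digamma values are harmonic
  numbers minus the Euler-Mascheroni constant, so the known bounds for that constant apply.\<close>

lemma summable_herglotz_at_1:
  "summable (\<lambda>n. (Digamma (real (Suc n)) - ln (real (Suc n))) / real (Suc n))"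
proof (rule summable_comparison_test_ev[OF _ summable_inverse_square_Suc])
  show "\<forall>\<^sub>F n in sequentially.
      norm ((Digamma (real (Suc n)) - ln (real (Suc n))) / real (Suc n)) \<le> 1 / (real (Suc n))\<^sup>2"
    using eventually_ge_at_top[of 1]
  proof eventually_elim
    case (elim n)
    have "\<bar>harm n - euler_mascheroni - ln (real (Suc n))\<bar> \<le> inverse (of_nat (2 * n))"
      using euler_mascheroni_bounds[OF elim]
        inverse_nonnegative_iff_nonnegative[of "real (2 * (n + 1))"]
      unfolding atLeastAtMost_iff by linarith
    also have "inverse (real (2 * n)) \<le> 1 / real (Suc n)"
      using elim by (simp add: field_simps)
    finally have "\<bar>Digamma (real (Suc n)) - ln (real (Suc n))\<bar> \<le> 1 / real (Suc n)"
      by (simp add: Digamma_of_nat del: of_nat_Suc)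
    then have "\<bar>Digamma (real (Suc n)) - ln (real (Suc n))\<bar> / real (Suc n)
        \<le> 1 / real (Suc n) / real (Suc n)"
      by (intro divide_right_mono) auto
    then show ?case by (simp add: power2_eq_square del: of_nat_Suc)
  qed
qed

lemma
  assumes x: "x > 0"
  shows summable_herglotz:
      "summable (\<lambda>n. (Digamma (real (Suc n) * x) - ln (real (Suc n) * x)) / real (Suc n))"
    and has_derivative_herglotz: "(herglotz has_real_derivative herglotz_deriv x) (at x)"
proof -
  define d where "d = min x 1 / 2"
  define f where
    "f n x = (Digamma (real (Suc n) * x) - ln (real (Suc n) * x)) / real (Suc n)" for n x
  define f' where "f' n x = Polygamma 1 (real (Suc n) * x) - 1 / (real (Suc n) * x)" for n x
  \<comment> \<open>The half-line beyond \<open>d\<close> contains both \<open>x\<close> and the point \<open>1\<close> of known convergence.\<close>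
  have d: "d > 0" "d < x" "d < 1" using x by (auto simp: d_def)
  have der: "(f n has_real_derivative f' n y) (at y within {d<..})" if "y \<in> {d<..}" for n y
  proof -
    have y: "y > 0" and p: "real (Suc n) * y > 0" using that d by (auto simp del: of_nat_Suc)
    have nn: "real (Suc n) * y \<notin> \<int>\<^sub>\<le>\<^sub>0" 
      using p nonpos_Ints_nonpos by fastforce
    have "((\<lambda>y. Digamma (real (Suc n) * y)) has_real_derivative
        Polygamma (Suc 0) (real (Suc n) * y) * real (Suc n)) (at y within {d<..})"
      by (rule DERIV_chain2[where f = Digamma and g = "\<lambda>y. real (Suc n) * y",
            OF has_field_derivative_Polygamma[OF nn, of 0]])
         (auto intro!: derivative_eq_intros)
    moreover have "((\<lambda>y. ln (real (Suc n) * y)) has_real_derivative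
        1 / y) (at y within {d<..})"
      using y p by (auto intro!: derivative_eq_intros simp del: of_nat_Suc)
    ultimately have "(f n has_real_derivative
       (Polygamma (Suc 0) (real (Suc n) * y) * real (Suc n) - 1 / y) / real (Suc n)) (at y within {d<..})"
      unfolding f_def by (intro DERIV_cdivide DERIV_diff)
    moreover have "(Polygamma (Suc 0) (real (Suc n) * y) * real (Suc n) - 1 / y) / real (Suc n) = f' n y"
      using y by (simp add: f'_def field_simps del: of_nat_Suc)
    ultimately show ?thesis by simp
  qed
  have bound: "norm (f' n y) \<le> inverse (d\<^sup>2) * (1 / (real (Suc n))\<^sup>2)" if "y \<in> {d<..}" for n y
  proof -
    have "norm (f' n y) \<le> 1 / (real (Suc n) * y)\<^sup>2"
      using Trigamma_bounds[of "real (Suc n) * y"] that d by (simp add: f'_def del: of_nat_Suc)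
    also have "\<dots> \<le> 1 / (real (Suc n) * d)\<^sup>2"
      using that d
      by (intro divide_left_mono power_mono mult_left_mono mult_pos_pos zero_less_power)
         (auto simp del: of_nat_Suc)
    finally show ?thesis by (simp add: power_mult_distrib field_simps del: of_nat_Suc)
  qed
  have unif: "uniformly_convergent_on {d<..} (\<lambda>n x. \<Sum>i<n. f' i x)"
    using bound summable_mult[OF summable_inverse_square_Suc]
    by (rule Weierstrass_m_test')
  have s1: "summable (\<lambda>n. f n 1)"
    using summable_herglotz_at_1 by (simp add: f_def)
  have int: "x \<in> interior {d<..}" using d by (simp add: interior_open)
  have *: "summable (\<lambda>n. f n x)" "((\<lambda>x. suminf (\<lambda>n. f n x)) has_field_derivative suminf (\<lambda>n. f' n x)) (at x)"
    using has_field_derivative_series'[OF convex_real_interval(3) der unif _ s1 int] d by auto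
  from * show "summable (\<lambda>n. (Digamma (real (Suc n) * x) - ln (real (Suc n) * x)) / real (Suc n))"
    "(herglotz has_real_derivative herglotz_deriv x) (at x)"
    by (simp_all add: f_def f'_def herglotz_def[abs_def] herglotz_deriv_def)
qed

lemma HZ_of_real:
  assumes x: "x > 0"
  shows "HZ (of_real x) = of_real (herglotz x)"
proof -
  have "(Digamma (of_nat (Suc n) * complex_of_real x) - Ln (of_nat (Suc n) * complex_of_real x))
        / of_nat (Suc n)
      = of_real ((Digamma (real (Suc n) * x) - ln (real (Suc n) * x)) / real (Suc n))" (is "?l n = ?r n") for n
  proof -
    have p: "real (Suc n) * x > 0" using x by (simp del: of_nat_Suc)
    have "of_nat (Suc n) * complex_of_real x = of_real (real (Suc n) * x)" by simp
    then show ?thesis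
      using p x Polygamma_of_real[of "real (Suc n) * x" 0, where 'a = complex]
      by (simp add: Ln_of_real[OF p] del: of_nat_Suc of_real_mult)
  qed
  then have "HZ (of_real x) = suminf ?r"
    unfolding HZ_def by (intro suminf_cong)
  then show ?thesis
    unfolding herglotz_def suminf_of_real[OF summable_herglotz[OF x]] .
qed

definition herglotz_tilde :: "real \<Rightarrow> real" where
  "herglotz_tilde x = herglotz x - herglotz 1 + pi\<^sup>2 / 12 * (x - 2 + inverse x) - (ln x)\<^sup>2 / 4"

lemma HZ_tilde_of_real:
  assumes "x > 0"
  shows "HZ_tilde (of_real x) = of_real (herglotz_tilde x)"
  using HZ_of_real[of x] HZ_of_real[of 1] assms
  by (simp add: HZ_tilde_def herglotz_tilde_def Ln_of_real)

text \<open>The finite part of the divergent sum of \<open>1 / (n x + m)\<^sup>2\<close> over the nonzero lattice points \<open>(n, m)\<close>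
  of the closed first quadrant, points on the two boundary rays counting one half. The Herglotz
  derivative counts the ray \<open>m = 0\<close> fully and omits the ray \<open>n = 0\<close>; these rays contribute
  \<open>\<pi>\<^sup>2 / (6 x\<^sup>2)\<close> and \<open>\<pi>\<^sup>2 / 6\<close>, which explains the correction.\<close>

definition regular_cone_sum :: "real \<Rightarrow> real" where
  "regular_cone_sum x = herglotz_deriv x + pi\<^sup>2 / 12 * (1 - 1 / x\<^sup>2)"

text \<open>The rational correction built into \<open>HZ_tilde\<close> is exactly the one that gives both boundary rays
  the weight one half.\<close>

lemma has_derivative_herglotz_tilde:
  assumes "x > 0"
  shows "(herglotz_tilde has_real_derivative regular_cone_sum x - ln x / (2 * x)) (at x)"
  unfolding herglotz_tilde_def[abs_def] regular_cone_sum_def using assms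
  by (auto intro!: derivative_eq_intros has_derivative_herglotz simp: field_simps power2_eq_square)

section \<open>The Rogers dilogarithm\<close>

lemma Li2_1: "Li2 1 = pi\<^sup>2 / 6"
  using inverse_squares_sums by (simp add: Li2_def sums_iff add_ac)

text \<open>The series is dominated by \<open>1 / k\<^sup>2\<close> on all of \<open>[0, 1]\<close>, so continuity includes the end
  point \<open>1\<close>.\<close>

lemma continuous_on_Li2: "continuous_on {0..1} Li2"
proof -
  have "uniform_limit {0..1} (\<lambda>n x. \<Sum>i<n. x ^ Suc i / (real (Suc i))\<^sup>2) Li2 sequentially"
    unfolding Li2_def[abs_def]
    by (rule Weierstrass_m_test[OF _ summable_inverse_square_Suc])
      (auto simp: power_abs power_le_one divide_right_mono simp del: of_nat_Suc power_Suc)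
  then show ?thesis
    by (rule uniform_limit_theorem[rotated]) (auto intro!: always_eventually continuous_intros)
qed

lemma has_derivative_Li2:
  assumes x: "0 < x" "x < 1"
  shows "(Li2 has_real_derivative - ln (1 - x) / x) (at x)"
proof -
  have "((\<lambda>x. suminf (\<lambda>n. (1 / (real (Suc n))\<^sup>2) * x ^ Suc n)) has_real_derivative
      suminf (\<lambda>n. (1 / (real (Suc n))\<^sup>2) * real (Suc n) * x ^ n)) (at x)"
  proof (rule DERIV_power_series'[where R = 1])
    fix y :: real assume "y \<in> {- 1<..<1}"
    then have y: "norm y < 1" by auto
    show "summable (\<lambda>n. (1 / (real (Suc n))\<^sup>2) * real (Suc n) * y ^ n)"
    proof (rule summable_comparison_test[OF _ summable_geometric[of "norm y"]])
      have "norm (1 / (real (Suc n))\<^sup>2 * real (Suc n) * y ^ n) \<le> norm y ^ n" for n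
      proof -
        have "norm (1 / (real (Suc n))\<^sup>2 * real (Suc n) * y ^ n) = norm y ^ n / real (Suc n)"
          by (simp add: power2_eq_square norm_mult norm_power norm_divide power_abs del: of_nat_Suc)
        also have "\<dots> \<le> norm y ^ n / 1"
          by (intro divide_left_mono) auto
        finally show ?thesis by simp
      qed
      then show "\<exists>N. \<forall>n\<ge>N. norm (1 / (real (Suc n))\<^sup>2 * real (Suc n) * y ^ n) \<le> norm y ^ n"
        by blast
    qed (use y in auto)
  qed (use x in auto)
  moreover have "suminf (\<lambda>n. (1 / (real (Suc n))\<^sup>2) * real (Suc n) * x ^ n) = - ln (1 - x) / x"
  proof -
    have "(\<lambda>n. - (x ^ n) / real n) sums ln (1 - x)"
      using ln_series'[of "- x"] x by simp
    then have "(\<lambda>n. - (x ^ n) / real n) sums (ln (1 - x) + - (x ^ 0) / real 0)"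
      by simp
    then have "(\<lambda>n. - (x ^ Suc n) / real (Suc n)) sums ln (1 - x)"
      by (rule sums_Suc_iff[of "\<lambda>n. - (x ^ n) / real n", THEN iffD2])
    then have "(\<lambda>n. (- 1 / x) * (- (x ^ Suc n) / real (Suc n))) sums ((- 1 / x) * ln (1 - x))"
      by (rule sums_mult)
    moreover have "(- 1 / x) * (- (x ^ Suc n) / real (Suc n)) 
        = (1 / (real (Suc n))\<^sup>2) * real (Suc n) * x ^ n" for n
      using x by (simp add: power2_eq_square field_simps del: of_nat_Suc)
    ultimately show ?thesis by (simp add: sums_iff)
  qed
  ultimately show ?thesis
    by (simp add: Li2_def[abs_def])
qed

lemma has_derivative_Rogers_L01:
  assumes "0 < t" "t < 1"
  shows "(Rogers_L01 has_real_derivative - (ln (1 - t) / t + ln t / (1 - t)) / 2) (at t)"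
proof -
  have a: "((\<lambda>t. 1 / 2 * ln t) has_real_derivative 1 / (2 * t)) (at t)"
    and b: "((\<lambda>t. ln (1 - t)) has_real_derivative - 1 / (1 - t)) (at t)"
    using assms by (auto intro!: derivative_eq_intros)
  have "- A / t + (1 / (2 * t) * A + - 1 / (1 - t) * (1 / 2 * B)) = - (A / t + B / (1 - t)) / 2"
    for A B
  proof -
    have "t \<noteq> 0" "1 - t \<noteq> 0" using assms by auto
    then show ?thesis by (simp add: divide_simps) algebra
  qed
  with DERIV_add[OF has_derivative_Li2[OF assms] DERIV_mult[OF a b]] show ?thesis
    unfolding Rogers_L01_def[abs_def] by metis
qed

text \<open>The reflection that defines \<open>Rogers_L\<close> beyond \<open>1\<close> continues the derivative by the same
  expression, once \<open>ln (1 - t)\<close> is read as \<open>ln \<bar>1 - t\<bar>\<close>.\<close>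

lemma has_derivative_Rogers_L:
  assumes "0 < t" "t \<noteq> 1"
  shows "(Rogers_L has_real_derivative - (ln \<bar>1 - t\<bar> / t + ln t / (1 - t)) / 2) (at t)"
proof (cases "t < 1")
  case True
  have "(Rogers_L01 has_real_derivative - (ln \<bar>1 - t\<bar> / t + ln t / (1 - t)) / 2) (at t)"
    using has_derivative_Rogers_L01[of t] assms True by simp
  then show ?thesis
    by (rule has_field_derivative_transform_within_open[where S = "{..<1}"])
      (use True in \<open>auto simp: Rogers_L_def\<close>)
next
  case False
  then have t: "t > 1" using assms by auto
  have "((\<lambda>t. pi\<^sup>2 / 3 - Rogers_L01 (1 / t)) has_real_derivative
      0 - (- (ln (1 - 1 / t) / (1 / t) + ln (1 / t) / (1 - 1 / t)) / 2) * (- 1 / t\<^sup>2)) (at t)"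
  proof (rule DERIV_diff[OF DERIV_const], rule DERIV_chain2[where g = "\<lambda>t. 1 / t"])
    show "(Rogers_L01 has_real_derivative
        - (ln (1 - 1 / t) / (1 / t) + ln (1 / t) / (1 - 1 / t)) / 2) (at (1 / t))"
      using t by (intro has_derivative_Rogers_L01) auto
    show "((\<lambda>t. 1 / t) has_real_derivative - 1 / t\<^sup>2) (at t)"
      using t by (auto intro!: derivative_eq_intros simp: power2_eq_square)
  qed
  moreover have "0 - (- (ln (1 - 1 / t) / (1 / t) + ln (1 / t) / (1 - 1 / t)) / 2) * (- 1 / t\<^sup>2)
      = - (ln \<bar>1 - t\<bar> / t + ln t / (1 - t)) / 2"
  proof -
    define r where "r = t - 1"
    have r: "t = 1 + r" "r > 0" using t by (auto simp: r_def)
    have "1 - 1 / t = r / t" using r by (simp add: field_simps)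
    then have "ln (1 - 1 / t) = ln r - ln t" "ln (1 / t) = - ln t" "1 - t = - r" "1 - 1 / t = r / t"
      using r by (simp_all add: ln_div)
    moreover have "0 - (- ((A - B) / (1 / t) + - B / (r / t)) / 2) * (- 1 / t\<^sup>2)
        = - (A / t + B / (- r)) / 2" for A B
    proof -
      have "t \<noteq> 0" "r \<noteq> 0" using r by auto
      then show ?thesis
        by (simp add: field_simps power2_eq_square) (use r(1) in algebra)
    qed
    ultimately show ?thesis
      using r(2) by (simp only: abs_minus_cancel abs_of_pos)
  qed
  ultimately have "((\<lambda>t. pi\<^sup>2 / 3 - Rogers_L01 (1 / t)) has_real_derivative
      - (ln \<bar>1 - t\<bar> / t + ln t / (1 - t)) / 2) (at t)"
    by (rule DERIV_cong)
  then show ?thesis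
    by (rule has_field_derivative_transform_within_open[where S = "{1<..}"])
      (use t in \<open>auto simp: Rogers_L_def\<close>)
qed

lemma Rogers_L_1: "Rogers_L 1 = pi\<^sup>2 / 6"
  by (simp add: Rogers_L_def Rogers_L01_def Li2_1)

lemma tendsto_Rogers_L01_1: "(Rogers_L01 \<longlongrightarrow> pi\<^sup>2 / 6) (at_left 1)"
proof -
  have "(Li2 \<longlongrightarrow> Li2 1) (at 1 within {0..1})"
    using continuous_on_Li2 by (auto simp: continuous_on_def)
  then have "(Li2 \<longlongrightarrow> pi\<^sup>2 / 6) (at_left 1)"
    by (simp add: at_within_Icc_at_left Li2_1)
  moreover have "((\<lambda>x::real. 1 / 2 * ln x * ln (1 - x)) \<longlongrightarrow> 0) (at_left 1)"
    by real_asymp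
  ultimately have "((\<lambda>x. Li2 x + 1 / 2 * ln x * ln (1 - x)) \<longlongrightarrow> pi\<^sup>2 / 6 + 0) (at_left 1)"
    by (rule tendsto_add)
  then show ?thesis
    unfolding Rogers_L01_def[abs_def] by simp
qed

text \<open>The reflection \<open>u \<mapsto> \<pi>\<^sup>2 / 3 - u\<close> fixes \<open>\<pi>\<^sup>2 / 6 = Li2 1\<close>, so both branches have this limit
  at \<open>1\<close>. It is the reason why the constant of integration in the main argument is an integral
  multiple of \<open>\<pi>\<^sup>2 / 6\<close>.\<close>

lemma isCont_Rogers_L:
  assumes "t > 0"
  shows "isCont Rogers_L t"
proof (cases "t = 1")
  case False
  then show ?thesis
    using has_derivative_Rogers_L[OF assms] DERIV_isCont by blast
next
  case True
  have "(Rogers_L \<longlongrightarrow> pi\<^sup>2 / 6) (at_left 1)"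
    by (rule Lim_transform_eventually[OF tendsto_Rogers_L01_1])
      (auto simp: eventually_at_filter Rogers_L_def)
  moreover have "(Rogers_L \<longlongrightarrow> pi\<^sup>2 / 6) (at_right 1)"
  proof -
    have "filterlim (\<lambda>t::real. 1 / t) (at_left 1) (at_right 1)"
      by real_asymp
    then have "((\<lambda>t. pi\<^sup>2 / 3 - Rogers_L01 (1 / t)) \<longlongrightarrow> pi\<^sup>2 / 3 - pi\<^sup>2 / 6) (at_right 1)"
      by (intro tendsto_intros filterlim_compose[OF tendsto_Rogers_L01_1])
    then have "((\<lambda>t. pi\<^sup>2 / 3 - Rogers_L01 (1 / t)) \<longlongrightarrow> pi\<^sup>2 / 6) (at_right 1)" by simp
    then show ?thesis
      by (rule Lim_transform_eventually) (auto simp: eventually_at_filter Rogers_L_def)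
  qed
  ultimately show ?thesis
    using True by (simp add: isCont_def filterlim_split_at Rogers_L_1)
qed

section \<open>Evaluating the boundary condition on homogeneous functions\<close>

lemma proj_point_abs_rep:
  fixes v :: "int^2"
  assumes "v \<noteq> 0"
  obtains c where "c \<noteq> 0" "rep_proj_line (proj_point v) = (\<chi> i. c * of_int (v $ i))"
proof -
  define w :: "real^2" where "w = (\<chi> i. of_int (v $ i))"
  have "w \<noteq> 0" using assms by (simp add: w_def vec_eq_iff)
  then have "proj_rel w w" by (auto simp: proj_rel_def intro: exI[of _ 1])
  then have "proj_rel (rep_proj_line (abs_proj_line w)) w"
    by (rule Quotient_rep_abs[OF Quotient_proj_line])
  then have "proj_rel w (rep_proj_line (abs_proj_line w))"
    using part_equivp_symp[OF part_equivp_proj_rel] by blast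
  then obtain c where "c \<noteq> 0" "rep_proj_line (abs_proj_line w) = c *\<^sub>R w"
    by (auto simp: proj_rel_def)
  then show thesis
    by (intro that[of c]) (auto simp: proj_point_def w_def vec_eq_iff)
qed

text \<open>A representative of a point of the projective line is determined up to a nonzero real factor, which
  may be negative. For points of the closed first quadrant the absolute values undo the sign, and
  homogeneity of degree \<open>0\<close> under positive factors does the rest.\<close>

definition quadrant_fun :: "(real \<Rightarrow> real \<Rightarrow> 'a) \<Rightarrow> proj_line \<Rightarrow> 'a" where
  "quadrant_fun H p = H \<bar>rep_proj_line p $ 1\<bar> \<bar>rep_proj_line p $ 2\<bar>"

lemma quadrant_fun_proj_point:
  fixes v :: "int^2"
  assumes hom: "\<And>k u w. k > 0 \<Longrightarrow> u \<ge> 0 \<Longrightarrow> w \<ge> 0 \<Longrightarrow> H (k * u) (k * w) = H u w"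
    and v: "v \<noteq> 0" "v $ 1 \<ge> 0" "v $ 2 \<ge> 0"
  shows "quadrant_fun H (proj_point v) = H (of_int (v $ 1)) (of_int (v $ 2))"
proof -
  obtain c where "c \<noteq> 0" "rep_proj_line (proj_point v) = (\<chi> i. c * of_int (v $ i))"
    using proj_point_abs_rep[OF v(1)] .
  then show ?thesis
    using hom[of "\<bar>c\<bar>" "of_int (v $ 1)" "of_int (v $ 2)"] v
    by (simp add: quadrant_fun_def abs_mult)
qed

lemma lookup_theta: "Poly_Mapping.lookup (theta n) M = of_bool (M \<in> S_set n)"
  using finite_S_set[of n] by (simp add: theta_def lookup_sum)

lemma keys_theta: "Poly_Mapping.keys (theta n) = S_set n"
  by (auto simp: in_keys_iff lookup_theta)

text \<open>A real function on the generators extends linearly to formal sums. Only finitely many generators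
  occur here, so the extension \<open>ev\<close> can be written as a sum over them.\<close>

lemma sum_eval_frag_diff:
  fixes h :: "'a \<Rightarrow> real"
  assumes A: "finite A"
    and eq: "(\<Sum>M\<in>A. frag_of (f M) - frag_of (g M)) = frag_of p - frag_of q"
  shows "(\<Sum>M\<in>A. h (f M) - h (g M)) = h p - h q"
proof -
  define P where "P = f ` A \<union> g ` A \<union> {p, q}"
  have P: "finite P" using A by (simp add: P_def)
  define ev where "ev c = (\<Sum>r\<in>P. of_int (Poly_Mapping.lookup c r) * h r)" for c
  have ev_frag: "ev (frag_of r) = h r" if "r \<in> P" for r
    using P that by (simp add: ev_def of_bool_def if_distrib[of of_int] if_distrib[of "\<lambda>x. x * _"] sum.delta cong: if_cong)
  have ev_diff: "ev (c - d) = ev c - ev d" for c d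
    by (simp add: ev_def lookup_minus sum_subtractf algebra_simps)
  have ev_sum: "ev (\<Sum>M\<in>A. F M) = (\<Sum>M\<in>A. ev (F M))" for F
    unfolding ev_def lookup_sum of_int_sum sum_distrib_right by (rule sum.swap)
  have "(\<Sum>M\<in>A. h (f M) - h (g M)) = (\<Sum>M\<in>A. ev (frag_of (f M) - frag_of (g M)))"
    by (intro sum.cong) (auto simp: ev_diff ev_frag P_def)
  also have "\<dots> = ev (frag_of p - frag_of q)"
    by (simp add: ev_sum[symmetric] eq)
  also have "\<dots> = h p - h q"
    by (simp add: ev_diff ev_frag P_def)
  finally show ?thesis .
qed

text \<open>The form in which the boundary condition is used: it evaluates every sum of differences
  of a degree \<open>0\<close> function between the two columns. The columns of a matrix in \<open>S_set n\<close> lie in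
  the closed first quadrant, which is why positive homogeneity suffices.\<close>

lemma cond_C_orbit_sum:
  fixes H :: "real \<Rightarrow> real \<Rightarrow> real"
  assumes C: "cond_C n (theta n)" and n: "n > 0"
    and orb: "\<alpha> \<in> M2 n // SL2_orbit_rel n"
    and hom: "\<And>k u v. k > 0 \<Longrightarrow> u \<ge> 0 \<Longrightarrow> v \<ge> 0 \<Longrightarrow> H (k * u) (k * v) = H u v"
  shows "(\<Sum>M\<in>\<alpha> \<inter> S_set n. H (M$1$1) (M$2$1) - H (M$1$2) (M$2$2)) = H 1 0 - H 0 1"
proof -
  have eq: "(\<Sum>M\<in>\<alpha> \<inter> S_set n. frag_of (proj_point (M *v col_infty)) - frag_of (proj_point (M *v col_zero)))
      = frag_of (proj_point col_infty) - frag_of (proj_point col_zero)"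
    using C orb by (simp add: cond_C_def keys_theta lookup_theta)
  have "(\<Sum>M\<in>\<alpha> \<inter> S_set n. quadrant_fun H (proj_point (M *v col_infty)) - quadrant_fun H (proj_point (M *v col_zero)))
      = quadrant_fun H (proj_point col_infty) - quadrant_fun H (proj_point col_zero)"
    by (rule sum_eval_frag_diff[OF _ eq]) (use finite_S_set in auto)
  moreover have "quadrant_fun H (proj_point (M *v col_infty)) = H (M$1$1) (M$2$1)"
      "quadrant_fun H (proj_point (M *v col_zero)) = H (M$1$2) (M$2$2)" if "M \<in> S_set n" for M
    using that n
    by (subst quadrant_fun_proj_point[of H, OF hom];
        force simp: S_set_def matrix_vector_mult_def sum_2 vec_eq_iff forall_2 vector_2)+
  moreover have "quadrant_fun H (proj_point col_infty) = H 1 0"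
      "quadrant_fun H (proj_point col_zero) = H 0 1"
    by (subst quadrant_fun_proj_point[of H, OF hom]; auto simp: vec_eq_iff forall_2 vector_2)+
  ultimately show ?thesis by simp
qed

section \<open>Classes of matrices and sublattices of prime index\<close>

definition mat2 :: "int \<Rightarrow> int \<Rightarrow> int \<Rightarrow> int \<Rightarrow> int^2^2" where
  "mat2 a b c d = vector [vector [a, b], vector [c, d]]"

lemma mat2_nth [simp]:
  "mat2 a b c d $ 1 $ 1 = a" "mat2 a b c d $ 1 $ 2 = b"
  "mat2 a b c d $ 2 $ 1 = c" "mat2 a b c d $ 2 $ 2 = d"
  by (simp_all add: mat2_def vector_2)

lemma mat2_mult: "mat2 a b c d ** mat2 e f g h = mat2 (a*e+b*g) (a*f+b*h) (c*e+d*g) (c*f+d*h)"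
  by (simp add: vec_eq_iff forall_2 matrix_matrix_mult_def sum_2)

lemma mat2_eta: "M = mat2 (M$1$1) (M$1$2) (M$2$1) (M$2$2)"
  by (simp add: vec_eq_iff forall_2)

lemma det_mat2: "det (mat2 a b c d) = a * d - b * c"
  by (simp add: det_2)

definition lattice_rep :: "int \<Rightarrow> int \<Rightarrow> int^2^2" where
  "lattice_rep l \<kappa> = (if \<kappa> = l then mat2 1 0 0 l else mat2 l \<kappa> 0 1)"

text \<open>For a prime \<open>l\<close> the sublattices of index \<open>l\<close> in the plane lattice correspond to the points of
  the projective line over the field with \<open>l\<close> elements: the lattices \<open>p \<equiv> \<kappa> q\<close> modulo \<open>l\<close>
  for \<open>0 \<le> \<kappa> < l\<close>, and the lattice \<open>q \<equiv> 0\<close>, which is given the index \<open>\<kappa> = l\<close>. The columns of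
  \<open>lattice_rep l \<kappa>\<close> form a basis.\<close>

definition in_lattice :: "int \<Rightarrow> int \<Rightarrow> int \<Rightarrow> int \<Rightarrow> bool" where
  "in_lattice l \<kappa> p q \<longleftrightarrow> (if \<kappa> = l then l dvd q else l dvd p - \<kappa> * q)"

definition lattice_orbit :: "int \<Rightarrow> int \<Rightarrow> (int^2^2) set" where
  "lattice_orbit l \<kappa> = SL2_orbit_rel l `` {lattice_rep l \<kappa>}"

lemma lattice_orbit_in_quotient: "lattice_orbit l \<kappa> \<in> M2 l // SL2_orbit_rel l"
  unfolding lattice_orbit_def by (intro quotientI) (auto simp: M2_def lattice_rep_def det_mat2)

text \<open>Two columns of determinant \<open>l\<close> inside a lattice of index \<open>l\<close> form a basis of it, hence differ
  from the basis \<open>lattice_rep l \<kappa>\<close> by a matrix of determinant \<open>1\<close>.\<close>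

lemma lattice_orbit_iff:
  assumes "l > 0"
  shows "M \<in> lattice_orbit l \<kappa> \<longleftrightarrow>
    det M = l \<and> in_lattice l \<kappa> (M$1$1) (M$2$1) \<and> in_lattice l \<kappa> (M$1$2) (M$2$2)"
proof -
  define a b c d where abcd: "a = M$1$1" "b = M$1$2" "c = M$2$1" "d = M$2$2"
  have M: "M = mat2 a b c d" unfolding abcd by (rule mat2_eta)
  have orb: "M \<in> lattice_orbit l \<kappa> \<longleftrightarrow>
      (\<exists>e f g h. e * h - f * g = 1 \<and> M = lattice_rep l \<kappa> ** mat2 e f g h)"
  proof -
    have "lattice_rep l \<kappa> \<in> M2 l"
      by (simp add: M2_def lattice_rep_def det_mat2)
    then have "M \<in> lattice_orbit l \<kappa> \<longleftrightarrow> (\<exists>g. det g = 1 \<and> M = lattice_rep l \<kappa> ** g)"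
      unfolding lattice_orbit_def SL2_orbit_rel_def by auto
    also have "\<dots> \<longleftrightarrow>
        (\<exists>e f g h. det (mat2 e f g h) = 1 \<and> M = lattice_rep l \<kappa> ** mat2 e f g h)"
      by (metis mat2_eta)
    finally show ?thesis by (simp only: det_mat2)
  qed
  have inj: "mat2 a b c d = mat2 a' b' c' d' \<longleftrightarrow> a = a' \<and> b = b' \<and> c = c' \<and> d = d'" for a' b' c' d'
    by (metis mat2_nth)
  show ?thesis
  proof (cases "\<kappa> = l")
    case True
    have "(\<exists>e f g h. e * h - f * g = 1 \<and> a = e \<and> b = f \<and> c = l * g \<and> d = l * h) \<longleftrightarrow>
        a * d - b * c = l \<and> l dvd c \<and> l dvd d"
    proof (rule iffI; elim exE conjE)
      fix e f g h :: int
      assume "e * h - f * g = 1" "a = e" "b = f" "c = l * g" "d = l * h"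
      moreover from this have "a * d - b * c = l" by algebra
      ultimately show "a * d - b * c = l \<and> l dvd c \<and> l dvd d" by simp
    next
      assume det: "a * d - b * c = l" and "l dvd c" "l dvd d"
      then obtain g h where gh: "c = l * g" "d = l * h" by (auto simp: dvd_def)
      then have "l * (a * h - b * g) = l * 1" using det by algebra
      then have "a * h - b * g = 1" using assms by simp
      then show "\<exists>e f g h. e * h - f * g = 1 \<and> a = e \<and> b = f \<and> c = l * g \<and> d = l * h"
        using gh by blast
    qed
    then show ?thesis
      unfolding orb unfolding M by (simp add: True lattice_rep_def in_lattice_def mat2_mult inj det_mat2)
  next
    case False
    have "(\<exists>e f g h. e * h - f * g = 1 \<and> a = l * e + \<kappa> * g \<and> b = l * f + \<kappa> * h \<and> c = g \<and> d = h) \<longleftrightarrow>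
        a * d - b * c = l \<and> l dvd a - \<kappa> * c \<and> l dvd b - \<kappa> * d"
    proof (rule iffI; elim exE conjE)
      fix e f g h :: int
      assume "e * h - f * g = 1" "a = l * e + \<kappa> * g" "b = l * f + \<kappa> * h" "c = g" "d = h"
      moreover from this have "a * d - b * c = l" by algebra
      ultimately show "a * d - b * c = l \<and> l dvd a - \<kappa> * c \<and> l dvd b - \<kappa> * d" by simp
    next
      assume det: "a * d - b * c = l" and "l dvd a - \<kappa> * c" "l dvd b - \<kappa> * d"
      then obtain e f where ef: "a - \<kappa> * c = l * e" "b - \<kappa> * d = l * f" by (auto simp: dvd_def)
      then have "l * (e * d - f * c) = l * 1" using det by algebra
      then have "e * d - f * c = 1" using assms by simp
      moreover have "a = l * e + \<kappa> * c" "b = l * f + \<kappa> * d" using ef by auto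
      ultimately show "\<exists>e f g h. e * h - f * g = 1 \<and> a = l * e + \<kappa> * g \<and> b = l * f + \<kappa> * h \<and> c = g \<and> d = h"
        by blast
    qed
    then show ?thesis
      unfolding orb unfolding M by (simp add: False lattice_rep_def in_lattice_def mat2_mult inj det_mat2)
  qed
qed

lemma in_lattice_imp_dvd_det:
  assumes "in_lattice l \<kappa> a c" "in_lattice l \<kappa> b d"
  shows "l dvd a * d - b * c"
proof (cases "\<kappa> = l")
  case True
  then show ?thesis using assms by (simp add: in_lattice_def)
next
  case False
  have "a * d - b * c = (a - \<kappa> * c) * d - (b - \<kappa> * d) * c" by algebra
  then show ?thesis using assms False by (simp add: in_lattice_def)
qed

text \<open>Modulo \<open>l\<close> a lattice of index \<open>l\<close> is a line, and a vector that is not \<open>0\<close> modulo \<open>l\<close>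
  spans it; vanishing of the determinant modulo \<open>l\<close> expresses proportionality.\<close>

lemma in_lattice_of_dvd_det:
  assumes l: "prime l" and "in_lattice l \<kappa> a c" "\<not> (l dvd a \<and> l dvd c)" "l dvd a * d - b * c"
  shows "in_lattice l \<kappa> b d"
proof (cases "\<kappa> = l")
  case True
  then have c: "l dvd c" "\<not> l dvd a" using assms by (auto simp: in_lattice_def)
  have "l dvd a * d - b * c + b * c" using assms c by (intro dvd_add) auto
  then show ?thesis using c l True by (simp add: in_lattice_def prime_dvd_mult_iff)
next
  case False
  then have a: "l dvd a - \<kappa> * c" using assms by (auto simp: in_lattice_def)
  have c: "\<not> l dvd c"
  proof
    assume "l dvd c"
    then have "l dvd (a - \<kappa> * c) + \<kappa> * c" using a by (intro dvd_add) auto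
    then show False using \<open>l dvd c\<close> assms by simp
  qed
  have "(b - \<kappa> * d) * c = (a - \<kappa> * c) * d - (a * d - b * c)" by algebra
  then have "l dvd (b - \<kappa> * d) * c" using a assms by (metis dvd_diff dvd_mult2)
  then show ?thesis using c l False by (simp add: in_lattice_def prime_dvd_mult_iff)
qed

lemma in_lattice_of_dvd: "l dvd p \<Longrightarrow> l dvd q \<Longrightarrow> in_lattice l \<kappa> p q"
  by (simp add: in_lattice_def)

lemma primitive_in_unique_lattice:
  assumes l: "prime l" and pq: "\<not> (l dvd p \<and> l dvd q)"
  shows "\<exists>\<kappa>. {\<kappa>. \<kappa> \<in> {0..l} \<and> in_lattice l \<kappa> p q} = {\<kappa>}"
proof (cases "l dvd q")
  case True
  moreover have "l dvd p - \<kappa> * q \<longleftrightarrow> l dvd p" for \<kappa>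
    using True by (metis diff_add_cancel dvd_add dvd_diff dvd_mult)
  ultimately have "{\<kappa>. \<kappa> \<in> {0..l} \<and> in_lattice l \<kappa> p q} = {l}"
    using pq True prime_gt_0_int[OF l] by (auto simp: in_lattice_def split: if_splits)
  then show ?thesis by blast
next
  case False
  have l0: "l > 0" using l by (rule prime_gt_0_int)
  have "coprime q l" using False l by (metis coprime_commute prime_imp_coprime)
  then obtain u v where uv: "u * q + v * l = 1"
    using bezout_int[of q l] by (auto simp: coprime_iff_gcd_eq_1)
  have iff: "l dvd p - \<kappa> * q \<longleftrightarrow> \<kappa> mod l = (p * u) mod l" for \<kappa>
  proof -
    have "l dvd p - \<kappa> * q \<longleftrightarrow> l dvd p * u - \<kappa>"
    proof
      assume "l dvd p - \<kappa> * q"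
      then have "l dvd u * (p - \<kappa> * q) - \<kappa> * v * l" by (metis dvd_diff dvd_mult dvd_triv_right)
      also have "u * (p - \<kappa> * q) - \<kappa> * v * l = p * u - \<kappa>" using uv by algebra
      finally show "l dvd p * u - \<kappa>" .
    next
      assume "l dvd p * u - \<kappa>"
      then have "l dvd q * (p * u - \<kappa>) + p * v * l" by (intro dvd_add dvd_mult) auto
      also have "q * (p * u - \<kappa>) + p * v * l = p - \<kappa> * q" using uv by algebra
      finally show "l dvd p - \<kappa> * q" .
    qed
    also have "\<dots> \<longleftrightarrow> (p * u) mod l = \<kappa> mod l" by (simp add: mod_eq_dvd_iff)
    finally show ?thesis by auto
  qed
  have mod: "0 \<le> (p * u) mod l" "(p * u) mod l < l"
    using l0 by auto
  have "{\<kappa>. \<kappa> \<in> {0..l} \<and> in_lattice l \<kappa> p q} = {(p * u) mod l}"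
  proof (intro set_eqI iffI)
    fix \<kappa> assume "\<kappa> \<in> {\<kappa>. \<kappa> \<in> {0..l} \<and> in_lattice l \<kappa> p q}"
    then show "\<kappa> \<in> {(p * u) mod l}"
      using False iff[of \<kappa>] by (cases "\<kappa> = l") (auto simp: in_lattice_def)
  next
    fix \<kappa> assume "\<kappa> \<in> {(p * u) mod l}"
    then show "\<kappa> \<in> {\<kappa>. \<kappa> \<in> {0..l} \<and> in_lattice l \<kappa> p q}"
      using mod iff[of "(p * u) mod l"] by (auto simp: in_lattice_def)
  qed
  then show ?thesis by blast
qed

text \<open>This count produces the Hecke eigenvalue: a vector divisible by \<open>l\<close> lies in all \<open>l + 1\<close>
  sublattices of index \<open>l\<close>, any other vector in just one.\<close>

lemma sum_in_lattice:
  assumes l: "prime l"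
  shows "(\<Sum>\<kappa>\<in>{0..l}. of_bool (in_lattice l \<kappa> p q)) = (1 + of_int l * of_bool (l dvd p \<and> l dvd q) :: real)"
proof (cases "l dvd p \<and> l dvd q")
  case True
  then show ?thesis using prime_gt_0_int[OF l] by (simp add: in_lattice_of_dvd)
next
  case False
  then obtain \<kappa> where "{\<kappa>. \<kappa> \<in> {0..l} \<and> in_lattice l \<kappa> p q} = {\<kappa>}"
    using primitive_in_unique_lattice[OF l] by blast
  moreover have "(\<Sum>\<kappa>\<in>{0..l}. of_bool (in_lattice l \<kappa> p q)) = real (card {\<kappa>. \<kappa> \<in> {0..l} \<and> in_lattice l \<kappa> p q})"
    by (simp add: of_bool_def sum.If_cases Int_def)
  ultimately show ?thesis using False by simp
qed

lemma ex1_iff_Collect: "(\<exists>!x. P x) \<longleftrightarrow> (\<exists>x. {x. P x} = {x})"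
  by (auto simp: set_eq_iff)

text \<open>The columns of \<open>M\<close> cannot both be divisible by \<open>l\<close>, since \<open>l\<^sup>2\<close> would divide the determinant;
  a column that is not divisible by \<open>l\<close> already determines the sublattice.\<close>

lemma ex1_lattice_orbit:
  assumes l: "prime l" and M: "det M = l"
  shows "\<exists>!\<kappa>. \<kappa> \<in> {0..l} \<and> M \<in> lattice_orbit l \<kappa>"
proof -
  define a b c d where abcd: "a = M$1$1" "b = M$1$2" "c = M$2$1" "d = M$2$2"
  have det: "a * d - b * c = l" using M by (simp add: abcd det_2)
  have l0: "l > 0" using l by (rule prime_gt_0_int)
  have orb: "M \<in> lattice_orbit l \<kappa> \<longleftrightarrow> in_lattice l \<kappa> a c \<and> in_lattice l \<kappa> b d" for \<kappa>
    using M by (simp add: lattice_orbit_iff[OF l0] abcd)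
  have "\<not> (l dvd a \<and> l dvd c) \<or> \<not> (l dvd b \<and> l dvd d)"
  proof (rule ccontr)
    assume "\<not> ?thesis"
    then have "l * l dvd a * d - b * c" by (intro dvd_diff) (auto intro: mult_dvd_mono simp: mult.commute[of b])
    then have "l * l dvd l * 1" using det by simp
    then have "l dvd 1" using l0 by (metis dvd_mult_cancel_left less_irrefl)
    then show False using l not_prime_unit by blast
  qed
  then show ?thesis
  proof
    assume n: "\<not> (l dvd a \<and> l dvd c)"
    then have "M \<in> lattice_orbit l \<kappa> \<longleftrightarrow> in_lattice l \<kappa> a c" for \<kappa>
      using in_lattice_of_dvd_det[OF l _ n, of \<kappa> d b] det orb by auto
    then show ?thesis using primitive_in_unique_lattice[OF l n] by (simp only: ex1_iff_Collect)
  next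
    assume n: "\<not> (l dvd b \<and> l dvd d)"
    have "l dvd b * c - a * d" using det by (metis dvd_minus_iff dvd_refl minus_diff_eq)
    then have "M \<in> lattice_orbit l \<kappa> \<longleftrightarrow> in_lattice l \<kappa> b d" for \<kappa>
      using in_lattice_of_dvd_det[OF l _ n, of \<kappa> c a] orb by auto
    then show ?thesis using primitive_in_unique_lattice[OF l n] by (simp only: ex1_iff_Collect)
  qed
qed

lemma sum_S_set_by_orbits:
  fixes f :: "int^2^2 \<Rightarrow> 'a :: comm_monoid_add"
  assumes l: "prime l"
  shows "(\<Sum>M\<in>S_set l. f M) = (\<Sum>\<kappa>\<in>{0..l}. \<Sum>M\<in>lattice_orbit l \<kappa> \<inter> S_set l. f M)"
proof -
  have det: "det M = l" if "M \<in> S_set l" for M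
    using that by (simp add: S_set_def)
  have "S_set l = (\<Union>\<kappa>\<in>{0..l}. lattice_orbit l \<kappa> \<inter> S_set l)"
    using ex1_lattice_orbit[OF l det] by blast
  then have "(\<Sum>M\<in>S_set l. f M) = (\<Sum>M\<in>(\<Union>\<kappa>\<in>{0..l}. lattice_orbit l \<kappa> \<inter> S_set l). f M)"
    by (rule arg_cong)
  also have "\<dots> = (\<Sum>\<kappa>\<in>{0..l}. \<Sum>M\<in>lattice_orbit l \<kappa> \<inter> S_set l. f M)"
  proof (rule sum.UNION_disjoint)
    show "\<forall>i\<in>{0..l}. \<forall>j\<in>{0..l}. i \<noteq> j \<longrightarrow>
        lattice_orbit l i \<inter> S_set l \<inter> (lattice_orbit l j \<inter> S_set l) = {}"
      using ex1_lattice_orbit[OF l det] by blast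
  qed (use finite_S_set in auto)
  finally show ?thesis .
qed

lemma cond_C_sum:
  fixes H :: "real \<Rightarrow> real \<Rightarrow> real"
  assumes l: "prime l" and C: "cond_C l (theta l)"
    and hom: "\<And>k u v. k > 0 \<Longrightarrow> u \<ge> 0 \<Longrightarrow> v \<ge> 0 \<Longrightarrow> H (k * u) (k * v) = H u v"
  shows "(\<Sum>M\<in>S_set l. H (M$1$1) (M$2$1) - H (M$1$2) (M$2$2)) = (of_int l + 1) * (H 1 0 - H 0 1)"
proof -
  have "l > 0" using l by (rule prime_gt_0_int)
  then show ?thesis
    unfolding sum_S_set_by_orbits[OF l]
    by (simp add: cond_C_orbit_sum[of l _ H, OF C _ lattice_orbit_in_quotient hom] add.commute)
qed

section \<open>The Moebius action\<close>

definition num :: "int^2^2 \<Rightarrow> real \<Rightarrow> real" where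
  "num M x = of_int (M$1$1) * x + of_int (M$2$1)"

definition den :: "int^2^2 \<Rightarrow> real \<Rightarrow> real" where
  "den M x = of_int (M$1$2) * x + of_int (M$2$2)"

lemma num_den_pos:
  assumes "M \<in> S_set l" "x > 0"
  shows "num M x > 0" "den M x > 0"
  unfolding num_def den_def using assms
  by (intro add_pos_nonneg add_nonneg_pos mult_pos_pos mult_nonneg_nonneg; simp add: S_set_def)+

lemma num_den_det:
  assumes "M \<in> S_set l"
  shows "of_int (M$1$1) * den M x - of_int (M$1$2) * num M x = of_int l"
proof -
  have "real_of_int (M$1$1) * of_int (M$2$2) - of_int (M$1$2) * of_int (M$2$1) = of_int l"
    using assms by (auto simp: S_set_def det_2 simp flip: of_int_mult of_int_diff)
  then show ?thesis by (simp add: num_def den_def algebra_simps)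
qed

text \<open>The right-hand side is a difference between the two columns of a function that is homogeneous of
  degree \<open>0\<close>, so the boundary condition can sum it.\<close>

lemma num_den_fraction:
  assumes "M \<in> S_set l" "x > 0"
  shows "of_int (M$1$1) / num M x - of_int (M$1$2) / den M x = of_int l / (num M x * den M x)"
  using num_den_pos[OF assms] num_den_det[OF assms(1), of x] by (simp add: field_simps)

lemma mobius_tr_num_den: "moebius_tr M x = num M x / den M x"
  by (simp add: moebius_tr_def num_def den_def)

lemma mobius_diff:
  assumes "M \<in> S_set l" "x > 0" "y > 0"
  shows "num M x / den M x - num M y / den M y = of_int l * (x - y) / (den M x * den M y)"
proof -
  have "num M x * den M y - num M y * den M x = of_int l * (x - y)"
    using num_den_det[OF assms(1), of 0] by (simp add: num_def den_def algebra_simps)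
  then show ?thesis
    using num_den_pos[OF assms(1)] assms by (simp add: diff_frac_eq less_imp_neq[symmetric])
qed

lemma sum_inverse_num_den:
  assumes l: "prime l" and C: "cond_C l (theta l)" and x: "x > 0"
  shows "(\<Sum>M\<in>S_set l. of_int l / (num M x * den M x)) = (of_int l + 1) / x"
proof -
  \<comment> \<open>The part of \<open>num_den_fraction\<close> that belongs to a single column.\<close>
  define H where "H u v = u / (u * x + v)" for u v :: real
  have hom: "H (k * u) (k * v) = H u v" if "k > 0" for k u v
  proof -
    have "k * u * x + k * v = k * (u * x + v)" by (simp add: algebra_simps)
    then show ?thesis using that by (simp add: H_def)
  qed
  have "(\<Sum>M\<in>S_set l. of_int l / (num M x * den M x)) =
      (\<Sum>M\<in>S_set l. H (M$1$1) (M$2$1) - H (M$1$2) (M$2$2))"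
  proof (intro sum.cong refl)
    fix M assume "M \<in> S_set l"
    then show "of_int l / (num M x * den M x) = H (M$1$1) (M$2$1) - H (M$1$2) (M$2$2)"
      using num_den_fraction[OF _ x] unfolding H_def num_def[symmetric] den_def[symmetric] by simp
  qed
  also have "\<dots> = (of_int l + 1) * (H 1 0 - H 0 1)"
    using hom by (intro cond_C_sum[OF l C]) auto
  finally show ?thesis by (simp add: H_def)
qed

section \<open>Cone sums\<close>

definition quadrant :: "(int \<times> int) set" where
  "quadrant = {0..} \<times> {0..}"

text \<open>On the closed quadrant: \<open>1\<close> inside, \<open>1 / 2\<close> on the two boundary rays and \<open>0\<close> at the origin.\<close>

definition edge_weight :: "int \<Rightarrow> int \<Rightarrow> real" where
  "edge_weight n m = (of_int (sgn n) + of_int (sgn m)) / 2"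

text \<open>The origin is harmless: there the base of the power is \<open>0\<close>, and so is the power.\<close>

definition cone_term :: "real \<Rightarrow> real \<Rightarrow> real \<Rightarrow> int \<times> int \<Rightarrow> real" where
  "cone_term s X X' = (\<lambda>(n, m). (of_int n * X + of_int m * X') powr (- (2 + s)))"

definition cone_sum :: "real \<Rightarrow> real \<Rightarrow> real \<Rightarrow> real" where
  "cone_sum s X X' = (\<Sum>\<^sub>\<infinity>(n, m)\<in>quadrant. edge_weight n m * cone_term s X X' (n, m))"

lemma hurwitz_scaled_summable:
  assumes "s > 0" "z > 0"
  shows "summable (\<lambda>k. hurwitz (1 + s) (real (Suc k) * z))"
proof (rule summable_comparison_test)
  define g where "g = (\<lambda>k. z powr (- (1 + s)) / (1 + s) * (1 + real k) powr (- (1 + s))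
      + z powr (- (2 + s)) * (1 + real k) powr (- (1 + (1 + s))))"
  show "summable g"
    unfolding g_def using assms
    by (intro summable_add summable_mult summable_hurwitz) auto
  have "norm (hurwitz (1 + s) (real (Suc k) * z)) \<le> g k" for k
  proof -
    have p: "real (Suc k) * z > 0" using assms by (simp del: of_nat_Suc)
    have "0 \<le> hurwitz (1 + s) (real (Suc k) * z)"
      using hurwitz_ge[of "1 + s" "real (Suc k) * z"] p assms
      by (meson add_nonneg_nonneg divide_nonneg_nonneg less_imp_le order_trans powr_ge_zero zero_le_one add_pos_pos zero_less_one)
    moreover have "hurwitz (1 + s) (real (Suc k) * z) \<le> g k"
      using hurwitz_le[of "1 + s" "real (Suc k) * z"] p assms
      by (simp add: g_def powr_mult mult.commute add_ac)
    ultimately show ?thesis by simp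
  qed
  then show "\<exists>N. \<forall>k\<ge>N. norm (hurwitz (1 + s) (real (Suc k) * z)) \<le> g k" by blast
qed

lemma summable_scaled_powr:
  assumes "s > 0" "z > 0"
  shows "summable (\<lambda>k. (real (Suc k) * z) powr (- (2 + s)))"
proof -
  have "summable (\<lambda>k. z powr (- (2 + s)) * (1 + real k) powr (- (1 + (1 + s))))"
    using assms by (intro summable_mult summable_hurwitz) auto
  then show ?thesis
    using assms by (simp add: powr_mult mult.commute add_ac)
qed

text \<open>Summing over \<open>m\<close> first turns every row into a Hurwitz sum. Row \<open>0\<close> lies on the boundary; in each
  later row only the term \<open>m = 0\<close> does, and half of it has to be removed.\<close>

lemma cone_has_sum_iterated:
  assumes s: "s > 0" and z: "z > 0"
  shows "((\<lambda>(n, m). edge_weight n m * cone_term s z 1 (n, m)) has_sum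
     (hurwitz (1 + s) 1 / 2 + suminf (\<lambda>k. hurwitz (1 + s) (real (Suc k) * z)
        - (real (Suc k) * z) powr (- (2 + s)) / 2))) quadrant"
proof -
  define q where "q = - (2 + s)"
  have q: "- (1 + (1 + s)) = q" by (simp add: q_def)
  define f where "f = (\<lambda>(n::nat, m::nat). edge_weight (int n) (int m) * (real n * z + real m) powr q)"
  define row where "row n = (case n of 0 \<Rightarrow> hurwitz (1 + s) 1 / 2
    | Suc k \<Rightarrow> hurwitz (1 + s) (real (Suc k) * z) - (real (Suc k) * z) powr q / 2)" for n
  have nonneg: "0 \<le> f (n, m)" for n m
    by (simp add: f_def edge_weight_def sgn_if)
  have row_sums: "(\<lambda>m. f (n, m)) sums row n" for n
  proof (cases n)
    case 0
    have "(\<lambda>m. (1 + real m) powr q / 2) sums (hurwitz (1 + s) 1 / 2)"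
      unfolding hurwitz_def q
      by (intro sums_divide summable_sums) (use summable_hurwitz[of "1 + s" 1, unfolded q] s in simp)
    then have "(\<lambda>m. f (0, Suc m)) sums row 0"
      by (simp add: f_def row_def edge_weight_def)
    then have "(\<lambda>m. f (0, m)) sums (row 0 + f (0, 0))"
      by (rule sums_Suc)
    then show ?thesis by (simp add: 0 f_def edge_weight_def)
  next
    case (Suc k)
    have p: "real (Suc k) * z > 0" using z by (simp del: of_nat_Suc)
    have "(\<lambda>m. (real (Suc k) * z + real m) powr q) sums hurwitz (1 + s) (real (Suc k) * z)"
      unfolding hurwitz_def q
      by (intro summable_sums) (use summable_hurwitz[of "1 + s" "real (Suc k) * z", unfolded q] s p in simp)
    then have "(\<lambda>m. (real (Suc k) * z + real (Suc m)) powr q) sums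
        (hurwitz (1 + s) (real (Suc k) * z) - (real (Suc k) * z) powr q)"
      by (subst sums_Suc_iff) simp
    also have "(\<lambda>m. (real (Suc k) * z + real (Suc m)) powr q) = (\<lambda>m. f (n, Suc m))"
      by (simp add: f_def Suc edge_weight_def del: of_nat_Suc)
    finally have "(\<lambda>m. f (n, m)) sums
        (hurwitz (1 + s) (real (Suc k) * z) - (real (Suc k) * z) powr q + f (n, 0))"
      by (rule sums_Suc)
    moreover have "hurwitz (1 + s) (real (Suc k) * z) - (real (Suc k) * z) powr q + f (n, 0) = row n"
    proof -
      have "f (n, 0) = (real (Suc k) * z) powr q / 2"
        by (simp add: f_def Suc edge_weight_def del: of_nat_Suc)
      then show ?thesis
        by (simp add: row_def Suc del: of_nat_Suc)
    qed
    ultimately show ?thesis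
      by metis
  qed
  have row_has_sum: "((\<lambda>m. f (n, m)) has_sum row n) UNIV" for n
    using row_sums nonneg by (rule sums_nonneg_imp_has_sum)
  have sum_rows: "summable (\<lambda>k. row (Suc k))"
    unfolding row_def q_def using hurwitz_scaled_summable[OF s z] summable_scaled_powr[OF s z]
    by (auto intro!: summable_diff summable_divide simp del: of_nat_Suc)
  have "row sums (suminf (\<lambda>k. row (Suc k)) + row 0)"
    using sum_rows by (intro sums_Suc summable_sums)
  moreover have "row n \<ge> 0" for n
    using row_has_sum[of n] nonneg by (rule has_sum_nonneg)
  ultimately have rows: "(row has_sum (suminf (\<lambda>k. row (Suc k)) + row 0)) UNIV"
    by (rule sums_nonneg_imp_has_sum)
  have "(f has_sum (suminf (\<lambda>k. row (Suc k)) + row 0)) (Sigma UNIV (\<lambda>_. UNIV))"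
  proof (rule has_sum_SigmaI[OF row_has_sum rows])
    show "f summable_on Sigma UNIV (\<lambda>_. UNIV)"
      using row_has_sum rows nonneg
      by (intro summable_on_SigmaI[where g = row]) (auto simp: summable_on_def)
  qed
  also have "?this \<longleftrightarrow> ((\<lambda>(n, m). edge_weight n m * cone_term s z 1 (n, m)) has_sum
      (suminf (\<lambda>k. row (Suc k)) + row 0)) quadrant"
    by (rule has_sum_reindex_bij_witness[where i = "\<lambda>(n, m). (nat n, nat m)"
          and j = "\<lambda>(n, m). (int n, int m)"])
       (auto simp: quadrant_def f_def cone_term_def q_def)
  finally show ?thesis by (simp add: row_def q_def add_ac)
qed

lemma cone_term_scale:
  assumes "X > 0" "X' > 0" "v \<in> quadrant"
  shows "cone_term s X X' v = X' powr (- (2 + s)) * cone_term s (X / X') 1 v"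
proof (cases v)
  case (Pair n m)
  have "of_int n * X + of_int m * X' = X' * (of_int n * (X / X') + of_int m * 1)"
    using assms by (simp add: field_simps)
  then show ?thesis
    using assms Pair by (simp add: cone_term_def quadrant_def powr_mult)
qed

lemma
  assumes s: "s > 0" and X: "X > 0" "X' > 0"
  shows cone_has_sum: "((\<lambda>(n, m). edge_weight n m * cone_term s X X' (n, m)) has_sum cone_sum s X X') quadrant"
    and cone_sum_scale: "cone_sum s X X' = X' powr (- (2 + s)) * cone_sum s (X / X') 1"
proof -
  have 1: "((\<lambda>(n, m). edge_weight n m * cone_term s (X / X') 1 (n, m)) has_sum cone_sum s (X / X') 1) quadrant"
    using cone_has_sum_iterated[OF s, of "X / X'"] X
    by (auto simp: cone_sum_def infsumI)
  have "((\<lambda>v. X' powr (- (2 + s)) * (case v of (n, m) \<Rightarrow> edge_weight n m * cone_term s (X / X') 1 (n, m)))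
      has_sum X' powr (- (2 + s)) * cone_sum s (X / X') 1) quadrant"
    by (rule has_sum_cmult_right[OF 1])
  then have 2: "((\<lambda>(n, m). edge_weight n m * cone_term s X X' (n, m)) has_sum
      X' powr (- (2 + s)) * cone_sum s (X / X') 1) quadrant"
    by (rule has_sum_cong[THEN iffD1, rotated]) (auto simp: cone_term_scale[OF X])
  then show "cone_sum s X X' = X' powr (- (2 + s)) * cone_sum s (X / X') 1"
    by (auto simp: cone_sum_def infsumI)
  with 2 show "((\<lambda>(n, m). edge_weight n m * cone_term s X X' (n, m)) has_sum cone_sum s X X') quadrant"
    by simp
qed

text \<open>The weight of the vector \<open>(p, q)\<close> of the quadrant with respect to the cone spanned by the columns
  of \<open>M\<close>: \<open>1\<close> inside the cone, \<open>1 / 2\<close> on its boundary rays, \<open>0\<close> outside. The two signs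
  tell on which side of each ray the vector lies.\<close>

definition cone_weight :: "int^2^2 \<Rightarrow> int \<Rightarrow> int \<Rightarrow> real" where
  "cone_weight M p q = (of_int (sgn (M$1$1 * q - M$2$1 * p)) - of_int (sgn (M$1$2 * q - M$2$2 * p))) / 2"

text \<open>Substituting \<open>(p, q) = M (n, m)\<close> turns the sum over the quadrant into a sum over the points of a
  sublattice in the cone of \<open>M\<close>, and Cramer's rule turns \<open>edge_weight\<close> into \<open>cone_weight\<close>. The
  remaining points of the sublattice in the quadrant have coordinates \<open>n\<close>, \<open>m\<close> of opposite
  signs, hence weight \<open>0\<close>.\<close>

lemma lattice_cone_has_sum:
  assumes l: "l > 0" and M: "M \<in> lattice_orbit l \<kappa>" "M \<in> S_set l" and s: "s > 0" and x: "x > 0"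
  shows "((\<lambda>(p, q). cone_weight M p q * cone_term s x 1 (p, q)) has_sum
     cone_sum s (num M x) (den M x))
     {(p, q) \<in> quadrant. in_lattice l \<kappa> p q}"
proof -
  define a b c d where abcd: "a = M$1$1" "b = M$1$2" "c = M$2$1" "d = M$2$2"
  have S: "0 \<le> b" "b < a" "0 \<le> c" "c < d" "a * d - b * c = l"
    using M(2) by (auto simp: S_set_def det_2 abcd)
  have lat: "in_lattice l \<kappa> a c" "in_lattice l \<kappa> b d"
    using M(1) by (simp_all add: lattice_orbit_iff[OF l] abcd)
  define X where "X = of_int a * x + of_int c"
  define X' where "X' = of_int b * x + of_int d"
  have X: "X > 0" "X' > 0"
    using num_den_pos[OF M(2) x] by (simp_all add: X_def X'_def num_def den_def abcd)
  define h where "h = (\<lambda>(n, m). (n * a + m * b, n * c + m * d))"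
  \<comment> \<open>Cramer's rule for the system with columns \<open>(a, c)\<close> and \<open>(b, d)\<close>.\<close>
  have cram: "a * (n * c + m * d) - c * (n * a + m * b) = m * l"
      "b * (n * c + m * d) - d * (n * a + m * b) = - (n * l)" for n m
    unfolding S(5)[symmetric] by (simp_all add: algebra_simps)
  have wt: "cone_weight M (n * a + m * b) (n * c + m * d) = edge_weight n m" for n m
    using l unfolding cone_weight_def abcd[symmetric] cram
    by (simp add: edge_weight_def sgn_mult)
  have inj: "inj_on h quadrant"
  proof (rule inj_onI)
    fix u v assume "h u = h v"
    moreover obtain n m n' m' where "u = (n, m)" "v = (n', m')" by fastforce
    ultimately show "u = v"
      using cram[of n m] cram[of n' m'] l by (auto simp: h_def)
  qed
  have "((\<lambda>(p, q). cone_weight M p q * cone_term s x 1 (p, q)) \<circ> h has_sum cone_sum s X X') quadrant"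
  proof (rule has_sum_cong[THEN iffD1, OF _ cone_has_sum[OF s X]])
    fix v assume "v \<in> quadrant"
    obtain n m where v: "v = (n, m)" by fastforce
    show "(case v of (n, m) \<Rightarrow> edge_weight n m * cone_term s X X' (n, m))
        = ((\<lambda>(p, q). cone_weight M p q * cone_term s x 1 (p, q)) \<circ> h) v"
      by (simp add: v h_def wt) (simp add: cone_term_def X_def X'_def algebra_simps)
  qed
  then have "((\<lambda>(p, q). cone_weight M p q * cone_term s x 1 (p, q)) has_sum cone_sum s X X') (h ` quadrant)"
    by (simp add: has_sum_reindex[OF inj])
  moreover have "h ` quadrant \<subseteq> {(p, q) \<in> quadrant. in_lattice l \<kappa> p q}"
  proof
    fix v assume "v \<in> h ` quadrant"
    then obtain n m where nm: "n \<ge> 0" "m \<ge> 0" "v = (n * a + m * b, n * c + m * d)"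
      by (auto simp: quadrant_def h_def)
    moreover have "in_lattice l \<kappa> (n * a + m * b) (n * c + m * d)"
    proof (cases "\<kappa> = l")
      case True
      then show ?thesis using lat by (simp add: in_lattice_def)
    next
      case False
      have "n * a + m * b - \<kappa> * (n * c + m * d) = n * (a - \<kappa> * c) + m * (b - \<kappa> * d)" by algebra
      then show ?thesis using lat False by (simp add: in_lattice_def)
    qed
    ultimately show "v \<in> {(p, q) \<in> quadrant. in_lattice l \<kappa> p q}"
      using S by (auto simp: quadrant_def)
  qed
  moreover have "cone_weight M p q = 0"
    if pq: "(p, q) \<in> quadrant" "in_lattice l \<kappa> p q" "(p, q) \<notin> h ` quadrant" for p q
  proof -
    have "l dvd a * q - p * c" "l dvd b * q - p * d"
      by (intro in_lattice_imp_dvd_det[OF lat(1) pq(2)] in_lattice_imp_dvd_det[OF lat(2) pq(2)])+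
    then obtain m k where "a * q - p * c = l * m" "b * q - p * d = l * k"
      by (auto simp: dvd_def)
    moreover define n where "n = - k"
    ultimately have nm: "a * q - c * p = m * l" "b * q - d * p = - (n * l)"
      by (simp_all add: mult.commute)
    have "l * p = l * (n * a + m * b)" "l * q = l * (n * c + m * d)"
      using nm S(5) by algebra+
    then have pq': "p = n * a + m * b" "q = n * c + m * d" using l by auto
    have "n < 0 \<or> m < 0"
      using pq(3) by (force simp: h_def quadrant_def pq' image_iff)
    moreover have "0 < m" if "n < 0"
    proof (rule ccontr)
      assume "\<not> 0 < m"
      then have "n * a < 0" "m * b \<le> 0"
        using that S by (auto intro: mult_neg_pos mult_nonpos_nonneg)
      then show False using pq(1) by (simp add: quadrant_def pq')
    qed
    moreover have "0 < n" if "m < 0"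
    proof (rule ccontr)
      assume "\<not> 0 < n"
      then have "m * d < 0" "n * c \<le> 0"
        using that S by (auto intro: mult_neg_pos mult_nonpos_nonneg)
      then show False using pq(1) by (simp add: quadrant_def pq')
    qed
    ultimately have "edge_weight n m = 0"
      by (auto simp: edge_weight_def)
    then show ?thesis by (simp add: pq' wt)
  qed
  ultimately show ?thesis
    unfolding num_def den_def abcd[symmetric] X_def[symmetric] X'_def[symmetric]
    by (subst has_sum_cong_neutral[where T = "h ` quadrant"]) auto
qed


text \<open>The cones of the matrices in one class fill the quadrant exactly once, boundaries counted half: the
  weight is the difference between the columns of the function \<open>H\<close>, which is homogeneous of
  degree \<open>0\<close>.\<close>

lemma cone_weight_orbit_sum:
  assumes l: "l > 0" and C: "cond_C l (theta l)"
  shows "(\<Sum>M\<in>lattice_orbit l \<kappa> \<inter> S_set l. cone_weight M p q) = edge_weight p q"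
proof -
  define H where "H u v = sgn (u * of_int q - v * of_int p) / 2" for u v :: real
  have hom: "H (k * u) (k * v) = H u v" if "k > 0" for k u v
  proof -
    have "k * u * of_int q - k * v * of_int p = k * (u * of_int q - v * of_int p)"
      by (simp add: algebra_simps)
    then show ?thesis using that by (simp add: H_def sgn_mult)
  qed
  have sgn_int: "sgn (of_int z :: real) = of_int (sgn z)" for z
    by (simp add: sgn_if)
  have "(\<Sum>M\<in>lattice_orbit l \<kappa> \<inter> S_set l. cone_weight M p q) =
      (\<Sum>M\<in>lattice_orbit l \<kappa> \<inter> S_set l. H (M$1$1) (M$2$1) - H (M$1$2) (M$2$2))"
    by (simp add: cone_weight_def H_def diff_divide_distrib flip: sgn_int)
  also have "\<dots> = H 1 0 - H 0 1"
    using hom by (intro cond_C_orbit_sum[OF C l lattice_orbit_in_quotient]) auto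
  also have "\<dots> = edge_weight p q"
    by (simp add: H_def edge_weight_def sgn_int sgn_minus add_divide_distrib)
  finally show ?thesis .
qed

lemma has_sum_sum:
  fixes f :: "'i \<Rightarrow> 'a \<Rightarrow> 'b :: topological_comm_monoid_add"
  assumes "finite I" "\<And>i. i \<in> I \<Longrightarrow> (f i has_sum S i) A"
  shows "((\<lambda>x. \<Sum>i\<in>I. f i x) has_sum (\<Sum>i\<in>I. S i)) A"
  using assms by (induction I rule: finite_induct) (auto intro: has_sum_add)

text \<open>Each class contributes the sum over a sublattice intersected with the whole quadrant. Adding up the
  sublattices counts every vector once and those divisible by \<open>l\<close> another \<open>l\<close> times; the latter
  sum is the original one scaled by \<open>l powr (- (2 + s))\<close>.\<close>

lemma cone_sum_hecke:
  assumes l: "prime l" and C: "cond_C l (theta l)" and s: "s > 0" and x: "x > 0"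
  shows "(\<Sum>M\<in>S_set l. cone_sum s (num M x) (den M x))
    = (1 + of_int l powr (- (1 + s))) * cone_sum s x 1"
proof -
  have l0: "l > 0" using l by (rule prime_gt_0_int)
  define G where "G M = cone_sum s (num M x) (den M x)"
    for M :: "int^2^2"
  define t where "t = (\<lambda>(p, q). edge_weight p q * cone_term s x 1 (p, q))"
  have orbit: "((\<lambda>v. of_bool (case v of (p, q) \<Rightarrow> in_lattice l \<kappa> p q) * t v) has_sum
      (\<Sum>M\<in>lattice_orbit l \<kappa> \<inter> S_set l. G M)) quadrant" for \<kappa>
  proof -
    have "((\<lambda>v. \<Sum>M\<in>lattice_orbit l \<kappa> \<inter> S_set l. case v of (p, q) \<Rightarrow>
        cone_weight M p q * cone_term s x 1 (p, q)) has_sum (\<Sum>M\<in>lattice_orbit l \<kappa> \<inter> S_set l. G M))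
        {(p, q) \<in> quadrant. in_lattice l \<kappa> p q}"
      unfolding G_def by (intro has_sum_sum lattice_cone_has_sum l0 s x) (use finite_S_set in auto)
    also have "?this \<longleftrightarrow> ?thesis"
      by (rule has_sum_cong_neutral)
        (auto simp: t_def sum_distrib_right[symmetric] cone_weight_orbit_sum[OF l0 C])
    finally show ?thesis .
  qed
  have total: "((\<lambda>v. (1 + of_int l * of_bool (case v of (p, q) \<Rightarrow> l dvd p \<and> l dvd q)) * t v) has_sum
      (\<Sum>M\<in>S_set l. G M)) quadrant"
  proof -
    have "((\<lambda>v. \<Sum>\<kappa>\<in>{0..l}. of_bool (case v of (p, q) \<Rightarrow> in_lattice l \<kappa> p q) * t v) has_sum
        (\<Sum>M\<in>S_set l. G M)) quadrant"
      unfolding sum_S_set_by_orbits[OF l] by (intro has_sum_sum orbit) auto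
    also have "?this \<longleftrightarrow> ?thesis"
    proof (rule has_sum_cong)
      fix v :: "int \<times> int"
      obtain p q where v: "v = (p, q)" by fastforce
      have "(\<Sum>\<kappa>\<in>{0..l}. of_bool (in_lattice l \<kappa> p q) * t v)
          = (\<Sum>\<kappa>\<in>{0..l}. of_bool (in_lattice l \<kappa> p q)) * t v"
        by (rule sum_distrib_right[symmetric])
      then show "(\<Sum>\<kappa>\<in>{0..l}. of_bool (case v of (p, q) \<Rightarrow> in_lattice l \<kappa> p q) * t v)
          = (1 + of_int l * of_bool (case v of (p, q) \<Rightarrow> l dvd p \<and> l dvd q)) * t v"
        unfolding v prod.case sum_in_lattice[OF l] .
    qed
    finally show ?thesis .
  qed
  have base: "(t has_sum cone_sum s x 1) quadrant"
    unfolding t_def using cone_has_sum[OF s x, of 1] by simp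
  have "((\<lambda>v. of_int l powr (- (2 + s)) * t v) has_sum of_int l powr (- (2 + s)) * cone_sum s x 1) quadrant"
    by (rule has_sum_cmult_right[OF base])
  also have "?this \<longleftrightarrow> (t has_sum of_int l powr (- (2 + s)) * cone_sum s x 1)
      {(p, q) \<in> quadrant. l dvd p \<and> l dvd q}"
  proof (rule has_sum_reindex_bij_witness[where i = "\<lambda>(p, q). (p div l, q div l)"
        and j = "\<lambda>(n, m). (l * n, l * m)"])
    fix v assume v: "v \<in> quadrant"
    obtain n m where nm: "v = (n, m)" by fastforce
    have "of_int (l * n) * x + of_int (l * m) * 1 = of_int l * (of_int n * x + of_int m * 1)"
      by (simp add: algebra_simps)
    moreover have "of_int n * x + of_int m * 1 \<ge> 0"
      using v x by (simp add: nm quadrant_def)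
    ultimately have "cone_term s x 1 (l * n, l * m) = of_int l powr (- (2 + s)) * cone_term s x 1 (n, m)"
      using l0 by (simp add: cone_term_def powr_mult)
    moreover have "edge_weight (l * n) (l * m) = edge_weight n m"
      using l0 by (simp add: edge_weight_def sgn_mult)
    ultimately show "t (case v of (n, m) \<Rightarrow> (l * n, l * m)) = of_int l powr (- (2 + s)) * t v"
      by (simp add: t_def nm)
  qed (use l0 in \<open>auto simp: quadrant_def pos_imp_zdiv_nonneg_iff zero_le_mult_iff\<close>)
  also have "\<dots> \<longleftrightarrow> ((\<lambda>v. of_bool (case v of (p, q) \<Rightarrow> l dvd p \<and> l dvd q) * t v) has_sum
      of_int l powr (- (2 + s)) * cone_sum s x 1) quadrant"
    by (rule has_sum_cong_neutral) auto
  finally have multiples: \<dots> .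
  have "((\<lambda>v. t v + of_int l * (of_bool (case v of (p, q) \<Rightarrow> l dvd p \<and> l dvd q) * t v)) has_sum
      cone_sum s x 1 + of_int l * (of_int l powr (- (2 + s)) * cone_sum s x 1)) quadrant"
    by (intro has_sum_add base has_sum_cmult_right multiples)
  moreover have "(\<lambda>v. t v + of_int l * (of_bool (case v of (p, q) \<Rightarrow> l dvd p \<and> l dvd q) * t v))
      = (\<lambda>v. (1 + of_int l * of_bool (case v of (p, q) \<Rightarrow> l dvd p \<and> l dvd q)) * t v)"
    by (simp add: distrib_right mult.assoc)
  ultimately have "(\<Sum>M\<in>S_set l. G M) =
      cone_sum s x 1 + of_int l * (of_int l powr (- (2 + s)) * cone_sum s x 1)"
    by (simp only:) (rule has_sum_unique[OF total])
  also have "of_int l * (of_int l powr (- (2 + s)) * cone_sum s x 1)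
      = of_int l powr (1 + (- (2 + s))) * cone_sum s x 1"
    using l0 by (simp only: powr_add) simp
  finally show ?thesis
    by (simp add: G_def algebra_simps)
qed

section \<open>The finite part of a cone sum\<close>

text \<open>A bound that does not depend on \<open>s\<close>, as Tannery's theorem demands; the factor is needed
  only for bases below \<open>1\<close>.\<close>

lemma powr_le_scaled_inverse_square:
  fixes z w s :: real
  assumes "0 < z" "z \<le> w" "0 \<le> s" "s \<le> 1"
  shows "w powr (- (2 + s)) \<le> (1 + 1 / z) * w powr (- 2)"
proof -
  have "w powr (- s) \<le> z powr (- s)"
    using assms by (intro powr_mono2') auto
  also have "z powr (- s) \<le> 1 + 1 / z"
  proof (cases "z \<ge> 1")
    case True
    then have "z powr (- s) \<le> z powr 0" using assms by (intro powr_mono) auto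
    then have "z powr (- s) \<le> 1" using assms by simp
    moreover have "1 / z \<ge> 0" using assms by simp
    ultimately show ?thesis by linarith
  next
    case False
    then have "z powr (- s) \<le> z powr (- 1)" using assms by (intro powr_mono') auto
    then show ?thesis using assms by (simp add: powr_minus_divide)
  qed
  finally have "w powr (- s) * w powr (- 2) \<le> (1 + 1 / z) * w powr (- 2)"
    by (intro mult_right_mono) auto
  then show ?thesis by (simp add: powr_add[symmetric] add.commute)
qed

lemma eventually_at_right_0_le_1: "\<forall>\<^sub>F s in at_right (0::real). 0 < s \<and> s \<le> 1"
  unfolding eventually_at_right_field by (intro exI[of _ 1]) auto

lemma tendsto_hurwitz:
  assumes z: "z > 0"
  shows "((\<lambda>s. hurwitz (1 + s) z) \<longlongrightarrow> hurwitz 1 z) (at_right 0)"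
proof -
  have "((\<lambda>s. suminf (\<lambda>k. (z + real k) powr (- (1 + (1 + s))))) \<longlongrightarrow>
      suminf (\<lambda>k. (z + real k) powr (- (1 + 1)))) (at_right 0)"
  proof (intro conjunct2[OF conjunct2[OF tannerys_theorem]])
    show "((\<lambda>s. (z + real k) powr (- (1 + (1 + s)))) \<longlongrightarrow> (z + real k) powr (- (1 + 1))) (at_right 0)" for k
      using z by (auto intro!: tendsto_eq_intros)
    show "\<forall>\<^sub>F (k, s) in sequentially \<times>\<^sub>F at_right 0. norm ((z + real k) powr (- (1 + (1 + s))))
        \<le> (1 + 1 / z) * (z + real k) powr (- (1 + 1))"
    proof (rule eventually_mono[OF eventually_prodI[OF always_eventually eventually_at_right_0_le_1]])
      show "\<forall>k. True" by simp
      fix v :: "nat \<times> real" assume "True \<and> 0 < snd v \<and> snd v \<le> 1"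
      then show "case v of (k, s) \<Rightarrow> norm ((z + real k) powr (- (1 + (1 + s))))
          \<le> (1 + 1 / z) * (z + real k) powr (- (1 + 1))"
        using powr_le_scaled_inverse_square[of z "z + real (fst v)" "snd v"] z
        by (cases v) (simp add: add.assoc)
    qed
    show "summable (\<lambda>k. (1 + 1 / z) * (z + real k) powr (- (1 + 1)))"
      using z by (intro summable_mult summable_hurwitz) auto
  qed auto
  then show ?thesis by (simp add: hurwitz_def)
qed

lemma hurwitz_1_1: "hurwitz 1 1 = pi\<^sup>2 / 6"
proof -
  have "(1 + real k) powr (- (1 + 1)) = 1 / (1 + real k)\<^sup>2" for k
    using powr_minus_two_nat[of "1 + real k"] by (simp add: inverse_eq_divide)
  then show ?thesis
    using inverse_squares_sums by (simp add: hurwitz_def sums_iff)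
qed

text \<open>The residue of the Riemann zeta function at its pole.\<close>

lemma tendsto_mult_hurwitz: "((\<lambda>s. s * hurwitz s 1) \<longlongrightarrow> 1) (at_right 0)"
proof (rule tendsto_sandwich)
  show "\<forall>\<^sub>F s in at_right 0. 1 \<le> s * hurwitz s 1"
    using eventually_at_right_0_le_1
    by eventually_elim (use hurwitz_ge[of _ 1] in \<open>auto simp: field_simps\<close>)
  show "\<forall>\<^sub>F s in at_right 0. s * hurwitz s 1 \<le> 1 + s"
    using eventually_at_right_0_le_1
    by eventually_elim (use hurwitz_le[of _ 1] in \<open>auto simp: field_simps\<close>)
  show "((\<lambda>s. 1 + s) \<longlongrightarrow> 1) (at_right (0::real))"
    by (auto intro!: tendsto_eq_intros)
qed auto

text \<open>The row of the cone sum that starts at \<open>w\<close> differs from \<open>w powr (- (1 + s)) / (1 + s)\<close>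
  by at most \<open>w powr (- (2 + s))\<close>. The subtracted multiple of \<open>hurwitz s 1\<close> is the sum of these leading
  terms, so what remains converges uniformly and the limit can be taken row by row.\<close>

lemma tendsto_cone_sum:
  assumes z: "z > 0"
  shows "((\<lambda>s. cone_sum s z 1 - z powr (- (1 + s)) * hurwitz s 1 / (1 + s)) \<longlongrightarrow> regular_cone_sum z) (at_right 0)"
proof -
  define w where "w n = real (Suc n) * z" for n
  have w: "w n > 0" "z \<le> w n" for n
    using z by (auto simp: w_def)
  define a where "a n s = hurwitz (1 + s) (w n) - w n powr (- (1 + s)) / (1 + s)
      - w n powr (- (2 + s)) / 2" for n s
  define b where "b n = hurwitz 1 (w n) - w n powr (- 1) - w n powr (- 2) / 2" for n
  have lim: "((\<lambda>s. suminf (\<lambda>n. a n s)) \<longlongrightarrow> suminf b) (at_right 0)"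
  proof (intro conjunct2[OF conjunct2[OF tannerys_theorem]])
    show "((\<lambda>s. a n s) \<longlongrightarrow> b n) (at_right 0)" for n
      unfolding a_def b_def using w[of n]
      by (intro tendsto_diff tendsto_hurwitz) (auto intro!: tendsto_eq_intros)
    show "\<forall>\<^sub>F (n, s) in sequentially \<times>\<^sub>F at_right 0. norm (a n s) \<le> (1 + 1 / z) * w n powr (- 2)"
    proof (rule eventually_mono[OF eventually_prodI[OF always_eventually eventually_at_right_0_le_1]])
      show "\<forall>k. True" by simp
      fix v :: "nat \<times> real" assume v: "True \<and> 0 < snd v \<and> snd v \<le> 1"
      obtain n s where ns: "v = (n, s)" by fastforce
      have "norm (a n s) \<le> w n powr (- (2 + s))"
        using hurwitz_ge[of "1 + s" "w n"] hurwitz_le[of "1 + s" "w n"] w[of n] v ns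
        by (simp add: a_def add.assoc[symmetric])
      also have "\<dots> \<le> (1 + 1 / z) * w n powr (- 2)"
        using v ns z w by (intro powr_le_scaled_inverse_square) auto
      finally show "case v of (n, s) \<Rightarrow> norm (a n s) \<le> (1 + 1 / z) * w n powr (- 2)"
        by (simp add: ns)
    qed
    have "summable (\<lambda>n. ((1 + 1 / z) * z powr (- 2)) * (1 + real n) powr (- (1 + 1)))"
      by (intro summable_mult summable_hurwitz) auto
    then show "summable (\<lambda>n. (1 + 1 / z) * w n powr (- 2))"
      using z by (simp add: w_def powr_mult mult_ac)
  qed auto
  have eq: "cone_sum s z 1 - z powr (- (1 + s)) * hurwitz s 1 / (1 + s) =
      hurwitz (1 + s) 1 / 2 + suminf (\<lambda>n. a n s)" if s: "s > 0" for s
  proof -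
    have "z powr (- (1 + s)) * (1 + real n) powr (- (1 + s)) = w n powr (- (1 + s))" for n
      using z by (simp add: w_def powr_mult mult.commute)
    then have 1: "(\<lambda>n. w n powr (- (1 + s)) / (1 + s)) sums (z powr (- (1 + s)) * hurwitz s 1 / (1 + s))"
      using sums_divide[OF sums_mult[OF summable_sums[OF summable_hurwitz[OF s, of 1]], of "z powr (- (1 + s))"], of "1 + s"]
      by (simp add: hurwitz_def)
    have 2: "(\<lambda>n. hurwitz (1 + s) (w n) - w n powr (- (2 + s)) / 2) sums (cone_sum s z 1 - hurwitz (1 + s) 1 / 2)"
    proof -
      have "summable (\<lambda>n. hurwitz (1 + s) (w n) - w n powr (- (2 + s)) / 2)"
        unfolding w_def
        by (intro summable_diff summable_divide hurwitz_scaled_summable summable_scaled_powr s z)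
      moreover have "cone_sum s z 1 = hurwitz (1 + s) 1 / 2 + suminf (\<lambda>n. hurwitz (1 + s) (w n) - w n powr (- (2 + s)) / 2)"
        unfolding cone_sum_def w_def by (rule infsumI[OF cone_has_sum_iterated[OF s z]])
      ultimately show ?thesis by (simp add: sums_iff)
    qed
    have "(\<lambda>n. a n s) sums (cone_sum s z 1 - hurwitz (1 + s) 1 / 2 - z powr (- (1 + s)) * hurwitz s 1 / (1 + s))"
      using sums_diff[OF 2 1] by (simp add: a_def algebra_simps)
    then show ?thesis by (simp add: sums_iff)
  qed
  have "((\<lambda>s. hurwitz (1 + s) 1 / 2 + suminf (\<lambda>n. a n s)) \<longlongrightarrow> hurwitz 1 1 / 2 + suminf b) (at_right 0)"
    by (intro tendsto_add tendsto_divide tendsto_hurwitz lim tendsto_const) auto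
  then have "((\<lambda>s. cone_sum s z 1 - z powr (- (1 + s)) * hurwitz s 1 / (1 + s)) \<longlongrightarrow> hurwitz 1 1 / 2 + suminf b) (at_right 0)"
    by (rule Lim_transform_eventually) (use eq in \<open>auto simp: eventually_at_filter\<close>)
  also have "hurwitz 1 1 / 2 + suminf b = regular_cone_sum z"
  proof -
    have "summable (\<lambda>n. Polygamma 1 (w n) - 1 / w n)"
    proof (rule summable_comparison_test)
      show "summable (\<lambda>n. 1 / z\<^sup>2 * (1 / (real (Suc n))\<^sup>2))"
        by (intro summable_mult summable_inverse_square_Suc)
      show "\<exists>N. \<forall>n\<ge>N. norm (Polygamma 1 (w n) - 1 / w n) \<le> 1 / z\<^sup>2 * (1 / (real (Suc n))\<^sup>2)"
        using Trigamma_bounds[OF w(1)] by (simp add: w_def power_mult_distrib mult.commute del: of_nat_Suc)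
    qed
    then have 1: "(\<lambda>n. Polygamma 1 (w n) - 1 / w n) sums herglotz_deriv z"
      by (simp add: herglotz_deriv_def w_def summable_sums)
    have 2: "(\<lambda>n. 1 / (2 * z\<^sup>2) * (1 / (real n + 1)\<^sup>2)) sums (1 / (2 * z\<^sup>2) * (pi\<^sup>2 / 6))"
      using sums_mult[OF inverse_squares_sums, of "1 / (2 * z\<^sup>2)"] by (simp add: add.commute)
    have "b n = Polygamma 1 (w n) - 1 / w n - 1 / (2 * z\<^sup>2) * (1 / (real n + 1)\<^sup>2)" for n
    proof -
      have "w n powr (- 2) / 2 = 1 / (2 * z\<^sup>2) * (1 / (real n + 1)\<^sup>2)"
        using w(1)[of n] by (simp add: powr_minus_two_nat) (simp add: w_def power_mult_distrib inverse_eq_divide add.commute mult.commute)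
      moreover have "w n powr (- 1) = 1 / w n"
        using w(1)[of n] by (simp add: powr_minus_divide)
      ultimately show ?thesis
        unfolding b_def by (simp only: Trigamma_eq_hurwitz[OF w(1)])
    qed
    then have "b = (\<lambda>n. Polygamma 1 (w n) - 1 / w n - 1 / (2 * z\<^sup>2) * (1 / (real n + 1)\<^sup>2))"
      by (rule ext)
    then have "b sums (herglotz_deriv z - 1 / (2 * z\<^sup>2) * (pi\<^sup>2 / 6))"
      using sums_diff[OF 1 2] by (simp only:)
    then show ?thesis
      by (simp add: sums_iff hurwitz_1_1 regular_cone_sum_def field_simps)
  qed
  finally show ?thesis .
qed

text \<open>The Hecke relation for \<open>s > 0\<close> involves only the full cone sums. Replacing them by their
  regularised versions leaves the multiple \<open>\<phi> s\<close> of the divergent factor \<open>hurwitz s 1 / (1 + s)\<close>.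
  As \<open>\<phi> 0 = 0\<close> by the boundary condition, that product tends to the derivative of \<open>\<phi>\<close> at \<open>0\<close>, and
  this is where the logarithms come from.\<close>

lemma regular_cone_sum_hecke:
  assumes l: "prime l" and C: "cond_C l (theta l)" and x: "x > 0"
  shows "(\<Sum>M\<in>S_set l. of_int l / (den M x)\<^sup>2 * regular_cone_sum (num M x / den M x)) - (of_int l + 1) * regular_cone_sum x
    = (\<Sum>M\<in>S_set l. of_int l / (num M x * den M x) * ln (num M x))
      - (of_int l + 1) * ln x / x - ln (of_int l) / x"
proof -
  define L where "L = real_of_int l"
  have L: "L > 0" using prime_gt_0_int[OF l] by (simp add: L_def)
  note pos = num_den_pos[OF _ x, of _ l]
  define reg where "reg z s = cone_sum s z 1 - z powr (- (1 + s)) * hurwitz s 1 / (1 + s)" for z s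
  define \<phi> where "\<phi> s = (L + L powr (- s)) * x powr (- (1 + s))
      - (\<Sum>M\<in>S_set l. L / den M x * num M x powr (- (1 + s)))" for s
  define \<phi>' where "\<phi>' = (\<Sum>M\<in>S_set l. L / (num M x * den M x) * ln (num M x)) - (L + 1) * ln x / x - ln L / x"
  define lhs where "lhs s = (\<Sum>M\<in>S_set l. L * den M x powr (- (2 + s)) * reg (num M x / den M x) s)
      - (L + L powr (- s)) * reg x s" for s
  have lhs_eq: "lhs s = hurwitz s 1 / (1 + s) * \<phi> s" if s: "s > 0" for s
  proof -
    have "(\<Sum>M\<in>S_set l. L * den M x powr (- (2 + s)) * reg (num M x / den M x) s) =
       (\<Sum>M\<in>S_set l. L * cone_sum s (num M x) (den M x)
          - hurwitz s 1 / (1 + s) * (L / den M x * num M x powr (- (1 + s))))"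
    proof (intro sum.cong refl)
      fix M assume M: "M \<in> S_set l"
      have "den M x powr (- (2 + s)) * (num M x / den M x) powr (- (1 + s))
          = num M x powr (- (1 + s)) * (den M x powr (- (2 + s)) * den M x powr (1 + s))"
      proof -
        have "(num M x / den M x) powr (- (1 + s)) = num M x powr (- (1 + s)) / den M x powr (- (1 + s))"
          by (rule powr_divide)
        then show ?thesis
          unfolding powr_minus_divide[of "den M x" "1 + s"] by simp
      qed
      also have "den M x powr (- (2 + s)) * den M x powr (1 + s) = 1 / den M x"
        using pos[OF M] by (simp add: powr_add[symmetric] powr_minus_divide)
      finally have e: "den M x powr (- (2 + s)) * (num M x / den M x) powr (- (1 + s))
          = num M x powr (- (1 + s)) / den M x" by simp
      have "L * den M x powr (- (2 + s)) * reg (num M x / den M x) s =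
          L * (den M x powr (- (2 + s)) * cone_sum s (num M x / den M x) 1)
          - L * hurwitz s 1 / (1 + s) * (den M x powr (- (2 + s)) * (num M x / den M x) powr (- (1 + s)))"
        by (simp add: reg_def right_diff_distrib)
      then show "L * den M x powr (- (2 + s)) * reg (num M x / den M x) s =
          L * cone_sum s (num M x) (den M x)
          - hurwitz s 1 / (1 + s) * (L / den M x * num M x powr (- (1 + s)))"
        by (simp only: e cone_sum_scale[OF s pos[OF M]]) simp
    qed
    also have "\<dots> = L * (\<Sum>M\<in>S_set l. cone_sum s (num M x) (den M x))
        - hurwitz s 1 / (1 + s) * (\<Sum>M\<in>S_set l. L / den M x * num M x powr (- (1 + s)))"
      by (simp only: sum_subtractf sum_distrib_left)
    also have "(\<Sum>M\<in>S_set l. cone_sum s (num M x) (den M x)) = (1 + L powr (- (1 + s))) * cone_sum s x 1"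
      using cone_sum_hecke[OF l C s x] by (simp add: L_def)
    also have "L * ((1 + L powr (- (1 + s))) * cone_sum s x 1) = (L + L powr (- s)) * cone_sum s x 1"
    proof -
      have "L * L powr (- (1 + s)) = L powr (1 + - (1 + s))"
        using L by (simp only: powr_add) simp
      then show ?thesis by (simp add: algebra_simps)
    qed
    finally have S: "(\<Sum>M\<in>S_set l. L * den M x powr (- (2 + s)) * reg (num M x / den M x) s)
        = (L + L powr (- s)) * cone_sum s x 1
          - hurwitz s 1 / (1 + s) * (\<Sum>M\<in>S_set l. L / den M x * num M x powr (- (1 + s)))" .
    show ?thesis
      unfolding lhs_def S unfolding \<phi>_def reg_def by (simp add: right_diff_distrib mult_ac)
  qed
  have "(lhs \<longlongrightarrow> (\<Sum>M\<in>S_set l. L * den M x powr (- (2 + 0)) * regular_cone_sum (num M x / den M x))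
      - (L + L powr (- 0)) * regular_cone_sum x) (at_right 0)"
    unfolding lhs_def reg_def
    by (intro tendsto_diff tendsto_sum tendsto_mult tendsto_cone_sum tendsto_add tendsto_powr
          tendsto_const tendsto_minus tendsto_ident_at x divide_pos_pos pos)
       (use L pos x in force)+
  then have lim1: "(lhs \<longlongrightarrow> (\<Sum>M\<in>S_set l. L / (den M x)\<^sup>2 * regular_cone_sum (num M x / den M x))
      - (L + 1) * regular_cone_sum x) (at_right 0)"
  proof (rule tendsto_eq_rhs, goal_cases)
    case 1
    have "(\<Sum>M\<in>S_set l. L * den M x powr (- (2 + 0)) * regular_cone_sum (num M x / den M x)) =
       (\<Sum>M\<in>S_set l. L / (den M x)\<^sup>2 * regular_cone_sum (num M x / den M x))"
      using pos by (intro sum.cong refl) (simp add: powr_minus_two_nat inverse_eq_divide)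
    then show ?case using L by simp
  qed
  have \<phi>0: "\<phi> 0 = 0"
  proof -
    have "(\<Sum>M\<in>S_set l. L / den M x * num M x powr (- (1 + 0))) = (\<Sum>M\<in>S_set l. L / (num M x * den M x))"
    proof (intro sum.cong refl)
      fix M assume "M \<in> S_set l"
      then show "L / den M x * num M x powr (- (1 + 0)) = L / (num M x * den M x)"
        using pos[of M] by (simp add: powr_minus_divide)
    qed
    then show ?thesis
      using sum_inverse_num_den[OF l C x] L x by (simp add: \<phi>_def L_def powr_minus_divide)
  qed
  \<comment> \<open>In the limit \<open>\<phi> s / s\<close> becomes this derivative, and \<open>s * hurwitz s 1\<close> becomes \<open>1\<close>.\<close>
  have der: "(\<phi> has_real_derivative \<phi>') (at 0)"
  proof -
    have d1: "((\<lambda>s. b powr (- (r + s))) has_real_derivative - ln b * b powr (- r)) (at 0)" if "b > 0" for b r :: real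
      using that by (auto intro!: derivative_eq_intros)
    have d0: "((\<lambda>s. L powr (- s)) has_real_derivative - ln L) (at 0)"
      using d1[of L 0] L by simp
    have dphi: "(\<phi> has_real_derivative
       (((0 + - ln L) * x powr (- (1 + 0)) + (- ln x * x powr (- 1)) * (L + L powr (- 0)))
        - (\<Sum>M\<in>S_set l. L / den M x * (- ln (num M x) * num M x powr (- 1))))) (at 0)"
      unfolding \<phi>_def[abs_def] using pos
      by (intro DERIV_diff DERIV_mult DERIV_add DERIV_const d0 d1 DERIV_sum DERIV_cmult x) auto
    have sumeq: "(\<Sum>M\<in>S_set l. L / den M x * (- ln (num M x) * num M x powr (- 1)))
        = - (\<Sum>M\<in>S_set l. L / (num M x * den M x) * ln (num M x))"
      unfolding sum_negf[symmetric]
    proof (intro sum.cong refl)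
      fix M assume "M \<in> S_set l"
      then show "L / den M x * (- ln (num M x) * num M x powr (- 1)) = - (L / (num M x * den M x) * ln (num M x))"
        using pos[of M] by (simp add: powr_minus_divide)
    qed
    show ?thesis
      by (rule DERIV_cong[OF dphi], unfold sumeq \<phi>'_def)
        (use x L in \<open>simp add: powr_minus_divide field_simps\<close>)
  qed
  have "((\<lambda>s. \<phi> s / s) \<longlongrightarrow> \<phi>') (at_right 0)"
    using has_field_derivative_at_within[OF der, of "{0<..}"] \<phi>0
    by (simp add: has_field_derivative_iff)
  then have "((\<lambda>s. (s * hurwitz s 1) / (1 + s) * (\<phi> s / s)) \<longlongrightarrow> 1 / (1 + 0) * \<phi>') (at_right 0)"
    by (intro tendsto_mult tendsto_divide tendsto_mult_hurwitz tendsto_add tendsto_const tendsto_ident_at) auto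
  then have "((\<lambda>s. (s * hurwitz s 1) / (1 + s) * (\<phi> s / s)) \<longlongrightarrow> \<phi>') (at_right 0)" by simp
  then have lim2: "(lhs \<longlongrightarrow> \<phi>') (at_right 0)"
    by (rule Lim_transform_eventually) (use lhs_eq in \<open>auto simp: eventually_at_filter\<close>)
  show ?thesis
    using tendsto_unique[OF _ lim1 lim2] by (simp add: \<phi>'_def L_def)
qed

section \<open>The elementary part of the derivative\<close>

definition refined_real :: "real \<Rightarrow> real \<Rightarrow> real" where
  "refined_real x y = herglotz_tilde x - herglotz_tilde y + Rogers_L (y / x)"

lemma refined_HZ_of_real:
  assumes "x > 0" "y > 0"
  shows "refined_HZ x y = of_real (refined_real x y)"
  using assms by (simp add: refined_HZ_def refined_real_def HZ_tilde_of_real)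

text \<open>The diagonal is excluded from the theorem; with \<open>Rogers_L 1\<close> the refined function extends
  continuously to it.\<close>

lemma refined_real_diagonal: "x > 0 \<Longrightarrow> refined_real x x = pi\<^sup>2 / 6"
  by (simp add: refined_real_def Rogers_L_1)

lemma isCont_herglotz_tilde: "x > 0 \<Longrightarrow> isCont herglotz_tilde x"
  using has_derivative_herglotz_tilde DERIV_isCont by blast

lemma isCont_refined_real:
  assumes "isCont f x" "isCont g x" "f x > 0" "g x > 0"
  shows "isCont (\<lambda>x. refined_real (f x) (g x)) x"
  unfolding refined_real_def using assms
  by (intro continuous_intros isCont_o2[OF _ isCont_herglotz_tilde] isCont_o2[OF _ isCont_Rogers_L]) auto

text \<open>The derivative of \<open>Rogers_L (y / x)\<close> together with the derivative of \<open>- (ln x)\<^sup>2 / 4\<close>.\<close>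

definition dilog_kernel :: "real \<Rightarrow> real \<Rightarrow> real" where
  "dilog_kernel x y = ln (\<bar>x - y\<bar> / (x * y)) / (2 * x) - (ln x - ln y) / (2 * (x - y))"

lemma has_derivative_Rogers_L_quotient:
  assumes x: "x > 0" and y: "y > 0" and "x \<noteq> y"
  shows "((\<lambda>x. Rogers_L (y / x)) has_real_derivative dilog_kernel x y + ln x / (2 * x)) (at x)"
proof -
  define t where "t = y / x"
  have t: "t > 0" "t \<noteq> 1" using assms by (auto simp: t_def)
  have "((\<lambda>x. y / x) has_real_derivative - y / x\<^sup>2) (at x)"
    using x by (auto intro!: derivative_eq_intros simp: power2_eq_square)
  from DERIV_chain2[OF has_derivative_Rogers_L[OF t, unfolded t_def] this]
  have d: "((\<lambda>x. Rogers_L (y / x)) has_real_derivative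
      - (ln \<bar>1 - y / x\<bar> / (y / x) + ln (y / x) / (1 - y / x)) / 2 * (- y / x\<^sup>2)) (at x)" .
  have "1 - y / x = (x - y) / x" using x by (simp add: field_simps)
  moreover from this have "ln \<bar>1 - y / x\<bar> = ln \<bar>x - y\<bar> - ln x"
    using assms by (simp add: abs_divide ln_div)
  moreover have "ln (y / x) = ln y - ln x" using assms by (simp add: ln_div)
  moreover have "dilog_kernel x y = (ln \<bar>x - y\<bar> - ln x - ln y) / (2 * x) - (ln x - ln y) / (2 * (x - y))"
    using assms by (simp add: dilog_kernel_def ln_div ln_mult)
  moreover have "- ((A - B) / (y / x) + (C - B) / (r / x)) / 2 * (- y / x\<^sup>2)
      = (A - B - C) / (2 * x) - (B - C) / (2 * r) + B / (2 * x)" if r: "r = x - y" for A B C r :: real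
  proof -
    have "r \<noteq> 0" "x \<noteq> 0" "y \<noteq> 0" using assms r by auto
    then show ?thesis
      by (simp add: field_simps power2_eq_square) (use r in algebra)
  qed
  ultimately show ?thesis using d by simp
qed

lemma has_derivative_refined_real:
  assumes "x > 0" "y > 0" "x \<noteq> y"
  shows "((\<lambda>x. refined_real x y) has_real_derivative regular_cone_sum x + dilog_kernel x y) (at x)"
proof -
  have "((\<lambda>x. herglotz_tilde x - herglotz_tilde y + Rogers_L (y / x)) has_real_derivative
      (regular_cone_sum x - ln x / (2 * x) - 0) + (dilog_kernel x y + ln x / (2 * x))) (at x)"
    by (intro DERIV_add DERIV_diff DERIV_const has_derivative_herglotz_tilde
          has_derivative_Rogers_L_quotient assms)
  then show ?thesis
    unfolding refined_real_def[abs_def] by (rule DERIV_cong) simp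
qed

text \<open>As a function of \<open>(u, v)\<close> this is homogeneous of degree \<open>0\<close>, so the boundary condition can sum
  its differences between the columns of a matrix.\<close>

definition kernel_potential :: "real \<Rightarrow> real \<Rightarrow> real \<Rightarrow> real \<Rightarrow> real" where
  "kernel_potential x y u v =
     u / (u * x + v) * ln \<bar>x - y\<bar> - ln ((u * x + v) / (u * y + v)) / (x - y)
      + u / (u * x + v) * ln ((u * x + v) / (u * y + v))"

text \<open>In terms of \<open>\<alpha> = a / X\<close>, \<open>\<beta> = b / X'\<close> and \<open>\<delta> = 1 / (x - y)\<close>, where \<open>X\<close> and \<open>X'\<close> are the
  numerator and denominator at \<open>x\<close> and \<open>(a, b)\<close> is the first row of \<open>M\<close>, both sides become
  linear in the logarithms and can be compared coefficient by coefficient. Every occurrence of \<open>y\<close> goes into the potential.\<close>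

lemma dilog_kernel_mobius:
  assumes M: "M \<in> S_set l" and l: "l > 0" and x: "x > 0" and y: "y > 0" and xy: "x \<noteq> y"
  shows "2 * (of_int l / (den M x)\<^sup>2 * dilog_kernel (num M x / den M x) (num M y / den M y)) =
    kernel_potential x y (M$1$1) (M$2$1) - kernel_potential x y (M$1$2) (M$2$2)
      + of_int l / (num M x * den M x) * (ln (of_int l) - 2 * ln (num M x))"
proof -
  define X X' Y Y' where XY: "X = num M x" "X' = den M x" "Y = num M y" "Y' = den M y"
  define L where "L = real_of_int l"
  define \<alpha> where "\<alpha> = of_int (M$1$1) / X"
  define \<beta> where "\<beta> = of_int (M$1$2) / X'"
  define \<delta> where "\<delta> = 1 / (x - y)"
  have pos: "X > 0" "X' > 0" "Y > 0" "Y' > 0" "L > 0"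
    using num_den_pos[OF M x] num_den_pos[OF M y] l by (auto simp: XY L_def)
  have nz: "X \<noteq> 0" "X' \<noteq> 0" "Y \<noteq> 0" "Y' \<noteq> 0" "L \<noteq> 0" "x - y \<noteq> 0"
    using pos xy by auto
  have diff: "X / X' - Y / Y' = L * (x - y) / (X' * Y')"
    using mobius_diff[OF M x y] by (simp add: XY L_def)
  have "\<bar>X / X' - Y / Y'\<bar> / (X / X' * (Y / Y')) = L * \<bar>x - y\<bar> / (X * Y)"
    unfolding diff using pos by (simp add: abs_mult)
  then have "dilog_kernel (X / X') (Y / Y') = (ln L + ln \<bar>x - y\<bar> - (ln X + ln Y)) / (2 * (X / X'))
      - ((ln X - ln X') - (ln Y - ln Y')) / (2 * (L * (x - y) / (X' * Y')))"
    unfolding dilog_kernel_def diff using pos xy by (simp add: ln_div ln_mult)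
  moreover have "2 * (L / X'\<^sup>2 * (A / (2 * (X / X')) - B / (2 * (L * (x - y) / (X' * Y')))))
      = L / (X * X') * A - (Y' / (X' * (x - y))) * B" for A B
    using nz by (simp add: field_simps power2_eq_square)
  ultimately have m: "2 * (L / X'\<^sup>2 * dilog_kernel (X / X') (Y / Y')) =
      L / (X * X') * (ln L + ln \<bar>x - y\<bar> - (ln X + ln Y))
      - (Y' / (X' * (x - y))) * ((ln X - ln X') - (ln Y - ln Y'))"
    by simp
  have f: "L / (X * X') = \<alpha> - \<beta>"
    using num_den_fraction[OF M x] by (simp add: XY L_def \<alpha>_def \<beta>_def)
  have g: "Y' / (X' * (x - y)) = \<delta> - \<beta>"
  proof -
    have "Y' = X' - of_int (M$1$2) * (x - y)"
      by (simp add: XY den_def algebra_simps)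
    then show ?thesis using nz by (simp add: \<delta>_def \<beta>_def field_simps)
  qed
  have h1: "kernel_potential x y (M$1$1) (M$2$1) = \<alpha> * ln \<bar>x - y\<bar> - \<delta> * (ln X - ln Y) + \<alpha> * (ln X - ln Y)"
    using pos unfolding kernel_potential_def num_def[symmetric] XY[symmetric]
    by (simp add: \<alpha>_def \<delta>_def ln_div)
  have h2: "kernel_potential x y (M$1$2) (M$2$2) = \<beta> * ln \<bar>x - y\<bar> - \<delta> * (ln X' - ln Y') + \<beta> * (ln X' - ln Y')"
    using pos unfolding kernel_potential_def den_def[symmetric] XY[symmetric]
    by (simp add: \<beta>_def \<delta>_def ln_div)
  show ?thesis
    unfolding XY[symmetric] L_def[symmetric] m f g h1 h2 by (simp add: algebra_simps)
qed

text \<open>The potentials add up to \<open>l + 1\<close> times the same difference for the identity matrix, so that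
  all terms with \<open>y\<close> cancel. The terms left over are those of \<open>regular_cone_sum_hecke\<close> with the
  opposite sign, except for the coefficient of \<open>ln l / x\<close>.\<close>

lemma dilog_kernel_hecke:
  assumes l: "prime l" and C: "cond_C l (theta l)" and x: "x > 0" and y: "y > 0" and xy: "x \<noteq> y"
  shows "(\<Sum>M\<in>S_set l. of_int l / (den M x)\<^sup>2 * dilog_kernel (num M x / den M x) (num M y / den M y))
      - (of_int l + 1) * dilog_kernel x y
    = (of_int l + 1) * ln x / x + (of_int l + 1) / 2 * ln (of_int l) / x
      - (\<Sum>M\<in>S_set l. of_int l / (num M x * den M x) * ln (num M x))"
proof -
  have l0: "l > 0" using l by (rule prime_gt_0_int)
  define H where "H = kernel_potential x y"
  have hom: "H (k * u) (k * v) = H u v" if "k > 0" for k u v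
  proof -
    have "k * u * x + k * v = k * (u * x + v)" "k * u * y + k * v = k * (u * y + v)"
      by (simp_all add: algebra_simps)
    then show ?thesis using that by (simp add: H_def kernel_potential_def)
  qed
  have "2 * (\<Sum>M\<in>S_set l. of_int l / (den M x)\<^sup>2 * dilog_kernel (num M x / den M x) (num M y / den M y))
     = (\<Sum>M\<in>S_set l. H (M$1$1) (M$2$1) - H (M$1$2) (M$2$2))
      + (\<Sum>M\<in>S_set l. of_int l / (num M x * den M x) * ln (of_int l))
      - 2 * (\<Sum>M\<in>S_set l. of_int l / (num M x * den M x) * ln (num M x))"
    unfolding sum_distrib_left sum.distrib[symmetric] sum_subtractf[symmetric] H_def
    by (intro sum.cong refl) (simp only: dilog_kernel_mobius[OF _ l0 x y xy], simp add: right_diff_distrib)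
  also have "(\<Sum>M\<in>S_set l. H (M$1$1) (M$2$1) - H (M$1$2) (M$2$2)) = (of_int l + 1) * (H 1 0 - H 0 1)"
    using hom by (intro cond_C_sum[OF l C]) auto
  also have "(\<Sum>M\<in>S_set l. of_int l / (num M x * den M x) * ln (of_int l)) = (of_int l + 1) / x * ln (of_int l)"
    by (simp only: sum_distrib_right[symmetric] sum_inverse_num_den[OF l C x])
  also have "H 1 0 - H 0 1 = 2 * (dilog_kernel x y + ln x / x)"
  proof -
    define q where "q = (ln x - ln y) / (x - y)"
    have "H 1 0 - H 0 1 = ln \<bar>x - y\<bar> / x - q + (ln x - ln y) / x"
      using x y by (simp add: H_def kernel_potential_def ln_div q_def)
    moreover have "dilog_kernel x y = (ln \<bar>x - y\<bar> - (ln x + ln y)) / (2 * x) - q / 2"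
    proof -
      have "(ln x - ln y) / (2 * (x - y)) = q / 2" by (simp add: q_def)
      then show ?thesis using x y xy by (simp add: dilog_kernel_def ln_div ln_mult)
    qed
    ultimately show ?thesis
      by (simp add: diff_divide_distrib add_divide_distrib)
  qed
  finally have main: "2 * (\<Sum>M\<in>S_set l. of_int l / (den M x)\<^sup>2 * dilog_kernel (num M x / den M x) (num M y / den M y))
     = (of_int l + 1) * (2 * (dilog_kernel x y + ln x / x)) + (of_int l + 1) / x * ln (of_int l)
      - 2 * (\<Sum>M\<in>S_set l. of_int l / (num M x * den M x) * ln (num M x))" .
  have "A - c * d = c * u + w / 2 - B" if "2 * A = c * (2 * (d + u)) + w - 2 * B" for A B c d u w :: real
  proof -
    have "c * (2 * (d + u)) = 2 * (c * d) + 2 * (c * u)" by (simp add: algebra_simps)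
    then show ?thesis using that by linarith
  qed
  from this[OF main] show ?thesis by simp
qed

section \<open>The Hecke relation\<close>

text \<open>For fixed \<open>y\<close> the difference of the two sides of the Hecke relation has derivative \<open>0\<close> in \<open>x\<close>
  away from \<open>x = y\<close>, and it is continuous there as well, hence constant. At \<open>x = y\<close> every refined
  function takes the value \<open>Rogers_L 1 = \<pi>\<^sup>2 / 6\<close> and the logarithm vanishes.\<close>

lemma refined_hecke_constant:
  assumes l: "prime l" and C: "cond_C l (theta l)" and x: "x > 0" and y: "y > 0"
  shows "(\<Sum>M\<in>S_set l. refined_real (num M x / den M x) (num M y / den M y))
      - ((of_int l + 1) * refined_real x y + (of_int l - 1) / 2 * ln (of_int l) * ln (x / y))
    = (real (card (S_set l)) - (of_int l + 1)) * (pi\<^sup>2 / 6)"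
proof -
  have l0: "l > 0" using l by (rule prime_gt_0_int)
  define D where "D x = (\<Sum>M\<in>S_set l. refined_real (num M x / den M x) (num M y / den M y))
      - ((of_int l + 1) * refined_real x y + (of_int l - 1) / 2 * ln (of_int l) * ln (x / y))" for x
  note pos_y = num_den_pos[OF _ y, of _ l]
  have "D x = (real (card (S_set l)) - (of_int l + 1)) * (pi\<^sup>2 / 6)"
  proof (rule has_derivative_zero_unique_strong_convex[where f = D and x = x
        and S = "{0<..}" and K = "{y}" and c = y])
    show "D y = (real (card (S_set l)) - (of_int l + 1)) * (pi\<^sup>2 / 6)"
      using y pos_y by (simp add: D_def refined_real_diagonal algebra_simps)
    show "continuous_on {0<..} D"
    proof (rule continuous_at_imp_continuous_on, rule ballI)
      fix z :: real assume "z \<in> {0<..}"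
      then have z: "z > 0" by simp
      note pos_z = num_den_pos[OF _ z, of _ l]
      have cont: "isCont (\<lambda>z. num M z / den M z) z" if "M \<in> S_set l" for M
        using pos_z(2)[OF that] unfolding num_def den_def by (intro continuous_intros) auto
      have c1: "isCont (\<lambda>x. refined_real (num M x / den M x) (num M y / den M y)) z"
        if "M \<in> S_set l" for M
        using pos_y[OF that] pos_z[OF that]
        by (intro isCont_refined_real cont[OF that] continuous_const) auto
      have c2: "isCont (\<lambda>x. refined_real x y) z"
        using y z by (intro isCont_refined_real continuous_ident continuous_const) auto
      have c3: "isCont (\<lambda>x. ln (x / y)) z"
        using y z by (intro continuous_intros) auto
      show "isCont D z"
        unfolding D_def[abs_def]
        by (intro continuous_diff continuous_add continuous_sum continuous_mult continuous_const c1 c2 c3)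
    qed
    fix z assume "z \<in> {0<..} - {y}"
    then have z: "z > 0" "z \<noteq> y" by auto
    note pos_z = num_den_pos[OF _ z(1), of _ l]
    have der: "((\<lambda>z. num M z / den M z) has_real_derivative of_int l / (den M z)\<^sup>2) (at z)"
      if "M \<in> S_set l" for M
    proof -
      have "((\<lambda>z. num M z / den M z) has_real_derivative
          (of_int (M$1$1) * den M z - num M z * of_int (M$1$2)) / (den M z * den M z)) (at z)"
        using pos_z(2)[OF that] unfolding num_def den_def
        by (auto intro!: derivative_eq_intros)
      then show ?thesis
        using num_den_det[OF that, of z] by (simp add: power2_eq_square mult.commute)
    qed
    have "(D has_real_derivative
        (\<Sum>M\<in>S_set l. (regular_cone_sum (num M z / den M z) + dilog_kernel (num M z / den M z) (num M y / den M y))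
            * (of_int l / (den M z)\<^sup>2))
        - ((of_int l + 1) * (regular_cone_sum z + dilog_kernel z y) + (of_int l - 1) / 2 * ln (of_int l) * (1 / z))) (at z)"
      unfolding D_def[abs_def]
    proof (intro DERIV_diff DERIV_add DERIV_sum DERIV_cmult has_derivative_refined_real z y)
      fix M assume M: "M \<in> S_set l"
      have "num M z / den M z \<noteq> num M y / den M y"
      proof
        assume "num M z / den M z = num M y / den M y"
        then show False
          using mobius_diff[OF M z(1) y] pos_y(2)[OF M] pos_z(2)[OF M] l0 z by simp
      qed
      then show "((\<lambda>x. refined_real (num M x / den M x) (num M y / den M y)) has_real_derivative
          (regular_cone_sum (num M z / den M z) + dilog_kernel (num M z / den M z) (num M y / den M y))
            * (of_int l / (den M z)\<^sup>2)) (at z)"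
        using pos_y[OF M] pos_z[OF M]
        by (intro DERIV_chain2[OF has_derivative_refined_real der[OF M]]) auto
    next
      show "((\<lambda>x. ln (x / y)) has_real_derivative 1 / z) (at z)"
        using y z by (auto intro!: derivative_eq_intros)
    qed
    also have "(\<Sum>M\<in>S_set l. (regular_cone_sum (num M z / den M z) + dilog_kernel (num M z / den M z) (num M y / den M y))
            * (of_int l / (den M z)\<^sup>2))
        = (\<Sum>M\<in>S_set l. of_int l / (den M z)\<^sup>2 * regular_cone_sum (num M z / den M z))
          + (\<Sum>M\<in>S_set l. of_int l / (den M z)\<^sup>2 * dilog_kernel (num M z / den M z) (num M y / den M y))"
      unfolding sum.distrib[symmetric] by (intro sum.cong refl) (simp add: algebra_simps)
    finally have "(D has_real_derivative 0) (at z)"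
    proof (rule DERIV_cong)
      have "(of_int l + 1) / 2 * ln (of_int l) / z = (of_int l - 1) / 2 * ln (of_int l) * (1 / z) + ln (of_int l) / z"
        using z by (simp add: field_simps)
      then show "(\<Sum>M\<in>S_set l. of_int l / (den M z)\<^sup>2 * regular_cone_sum (num M z / den M z))
          + (\<Sum>M\<in>S_set l. of_int l / (den M z)\<^sup>2 * dilog_kernel (num M z / den M z) (num M y / den M y))
          - ((of_int l + 1) * (regular_cone_sum z + dilog_kernel z y) + (of_int l - 1) / 2 * ln (of_int l) * (1 / z)) = 0"
        using regular_cone_sum_hecke[OF l C z(1)] dilog_kernel_hecke[OF l C z(1) y z(2)]
        unfolding distrib_left by linarith
    qed
    then show "(D has_derivative (\<lambda>h. 0)) (at z within {0<..})"
      unfolding lambda_zero has_field_derivative_def[symmetric] by (rule has_field_derivative_at_within)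
  qed (use x y in auto)
  then show ?thesis by (simp add: D_def)
qed

theorem theorem1:
  fixes l :: nat
  assumes "prime l"
    and "cond_C (int l) (theta (int l))"
  shows "\<forall>x y :: real. x > 0 \<and> y > 0 \<and> x \<noteq> y \<longrightarrow>
    (\<exists>k :: int.
      slash_theta refined_HZ (int l) x y
        - (of_nat (l + 1) * refined_HZ x y
             + of_real ((real l - 1) / 2 * ln (real l) * ln (x / y)))
      = of_int k * of_real (pi\<^sup>2 / 6))"
proof (intro allI impI)
  fix x y :: real assume xy: "x > 0 \<and> y > 0 \<and> x \<noteq> y"
  have l: "prime (int l)" using assms(1) by simp
  have "slash_theta refined_HZ (int l) x y =
      of_real (\<Sum>M\<in>S_set (int l). refined_real (num M x / den M x) (num M y / den M y))"
    unfolding slash_theta_def slash_def mobius_tr_num_den of_real_sum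
    using xy num_den_pos by (intro sum.cong refl refined_HZ_of_real) auto
  moreover have "refined_HZ x y = of_real (refined_real x y)"
    using xy by (intro refined_HZ_of_real) auto
  ultimately have "slash_theta refined_HZ (int l) x y
        - (of_nat (l + 1) * refined_HZ x y
             + of_real ((real l - 1) / 2 * ln (real l) * ln (x / y)))
      = of_real ((\<Sum>M\<in>S_set (int l). refined_real (num M x / den M x) (num M y / den M y))
      - ((of_int (int l) + 1) * refined_real x y
          + (of_int (int l) - 1) / 2 * ln (of_int (int l)) * ln (x / y)))"
    by simp
  also have "\<dots> = of_real ((real (card (S_set (int l))) - (of_int (int l) + 1)) * (pi\<^sup>2 / 6))"
    using xy by (subst refined_hecke_constant[OF l assms(2)]) auto
  also have "\<dots> = of_int (int (card (S_set (int l))) - (int l + 1)) * of_real (pi\<^sup>2 / 6)"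
    by simp
  finally show "\<exists>k :: int.
      slash_theta refined_HZ (int l) x y
        - (of_nat (l + 1) * refined_HZ x y
             + of_real ((real l - 1) / 2 * ln (real l) * ln (x / y)))
      = of_int k * of_real (pi\<^sup>2 / 6)" by blast
qed

end
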